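(* Let $g>0$, $\rho_+>\rho_->0$, $[\rho]:=\rho_+-\rho_->0$, $\mu_\pm>0$ and $B\in\mathbb{R}\setminus\{0\}$. For $\xi\in\mathbb{R}$ and $\lambda>0$ consider the problem (horizontal magnetic field) of finding $\psi:[-1,1]\to\mathbb{R}$, whose restrictions to $[-1,0]$ and $[0,1]$ are $C^4$, such that on $(-1,0)\cup(0,1)$ $$-\lambda^2\rho(\xi^2\psi-\psi'')=\mu\lambda(\xi^4\psi-2\xi^2\psi''+\psi'''')+|B|^2(\xi^4\psi-\xi^2\psi''),$$ with the jump conditions $$\llbracket\psi\rrbracket=\llbracket\psi'\rrbracket=0,\qquad \llbracket\mu\lambda(\xi^2\psi+\psi'')\rrbracket=0,\qquad \llbracket\mu\lambda(\psi'''-3\xi^2\psi')\rrbracket=\llbracket\lambda^2\rho\psi'\rrbracket+g[\rho]\xi^2\psi(0),$$ and the boundary conditions $\psi(-1)=\psi(1)=\psi'(-1)=\psi'(1)=0$. Then: (i) if $|B|\ge|B|_c$, then for every $\xi\in\mathbb{R}$ there is no nontrivial solution $\psi$ with $\lambda>0$; (ii) if $|B|<|B|_c$, then for every $\xi\in\mathbb{R}$ with $|\xi|\ge|\xi|_{hc}^B$ there is no nontrivial solution $\psi$ with $\lambda>0$; (iii) if $|B|<|B|_c$, then for every $\xi\in\mathbb{R}$ with $0<|\xi|<|\xi|^B_{hc}$ there exist $\lambda(\xi)>0$ and a solution $\psi=\psi(\xi,x_2)$ of the problem; moreover $\psi$ and $\lambda$ are even in $\xi$, $\psi$ is smooth when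 restricted to $(-1,0)$ or $(0,1)$, and $\psi(\xi,0)\neq0$.
   Context: Here $\rho(x_2)=\rho_+$ and $\mu(x_2)=\mu_+$ for $x_2\in(0,1)$, $\rho(x_2)=\rho_-$ and $\mu(x_2)=\mu_-$ for $x_2\in(-1,0)$; primes denote $d/dx_2$; $\llbracket f\rrbracket:=f(0^+)-f(0^-)$. The critical magnetic number is $|B|_c^2:=\sup\{ g[\rho]\psi(0)^2/\int_{-1}^1|\psi'|^2dx_2 : \psi\in H_0^1((-1,1)),\ \psi\ne0\}$. For $|B|<|B|_c$ the critical frequency is $(|\xi|^B_{hc})^2:=\sup\Big\{\frac{g[\rho]\psi(0)^2-|B|^2\int_{-1}^1|\psi'|^2dx_2}{|B|^2\int_{-1}^1|\psi|^2dx_2}:\ \psi\in H_0^1((-1,1)),\ \psi\neq0\Big\}$. The ODE problem arises from normal modes of the linearized 2D viscous, zero-resistivity MHD Rayleigh–Taylor problem in the slab $\mathbb{R}\times(-1,1)$ with constant horizontal magnetic field $(B,0)$. *)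

theory Defs
  imports "HOL-Analysis.Analysis"
begin

definition Ck_on :: "nat \<Rightarrow> real set \<Rightarrow> (real \<Rightarrow> real) \<Rightarrow> (nat \<Rightarrow> real \<Rightarrow> real) \<Rightarrow> bool" where
  "Ck_on n S f d \<longleftrightarrow> (\<forall>x\<in>S. d 0 x = f x) \<and>
     (\<forall>k<n. \<forall>x\<in>S. (d k has_real_derivative d (Suc k) x) (at x within S)) \<and>
     continuous_on S (d n)"

definition smooth_on :: "real set \<Rightarrow> (real \<Rightarrow> real) \<Rightarrow> bool" where
  "smooth_on S f \<longleftrightarrow> (\<exists>d :: nat \<Rightarrow> real \<Rightarrow> real. (\<forall>x\<in>S. d 0 x = f x) \<and>
     (\<forall>k. \<forall>x\<in>S. (d k has_real_derivative d (Suc k) x) (at x)))"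

text \<open>The normal-mode ODE problem with horizontal magnetic field (B,0).
  dL, dR are the derivative families (orders 0..4) of the restrictions of psi to [-1,0] and [0,1];
  jumps f(0+) - f(0-) are expressed via dR _ 0 - dL _ 0; the jump of psi itself vanishes
  automatically since both restrictions agree with psi at 0.\<close>
definition is_solution ::
  "real \<Rightarrow> real \<Rightarrow> real \<Rightarrow> real \<Rightarrow> real \<Rightarrow> real \<Rightarrow> real \<Rightarrow> real \<Rightarrow> (real \<Rightarrow> real) \<Rightarrow> bool" where
  "is_solution g rhop rhom mup mum B \<xi> lam psi \<longleftrightarrow>
    (\<exists>dL dR.
      Ck_on 4 {-1..0} psi dL \<and> Ck_on 4 {0..1} psi dR \<and>
      (\<forall>x\<in>{-1<..<0}.
         - (lam^2 * rhom * (\<xi>^2 * dL 0 x - dL 2 x))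
         = mum * lam * (\<xi>^4 * dL 0 x - 2 * \<xi>^2 * dL 2 x + dL 4 x)
           + \<bar>B\<bar>^2 * (\<xi>^4 * dL 0 x - \<xi>^2 * dL 2 x)) \<and>
      (\<forall>x\<in>{0<..<1}.
         - (lam^2 * rhop * (\<xi>^2 * dR 0 x - dR 2 x))
         = mup * lam * (\<xi>^4 * dR 0 x - 2 * \<xi>^2 * dR 2 x + dR 4 x)
           + \<bar>B\<bar>^2 * (\<xi>^4 * dR 0 x - \<xi>^2 * dR 2 x)) \<and>
      dR 0 0 - dL 0 0 = 0 \<and>
      dR 1 0 - dL 1 0 = 0 \<and>
      mup * lam * (\<xi>^2 * dR 0 0 + dR 2 0) - mum * lam * (\<xi>^2 * dL 0 0 + dL 2 0) = 0 \<and>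
      mup * lam * (dR 3 0 - 3 * \<xi>^2 * dR 1 0) - mum * lam * (dL 3 0 - 3 * \<xi>^2 * dL 1 0)
        = (lam^2 * rhop * dR 1 0 - lam^2 * rhom * dL 1 0) + g * (rhop - rhom) * \<xi>^2 * psi 0 \<and>
      psi (-1) = 0 \<and> psi 1 = 0 \<and> dL 1 (-1) = 0 \<and> dR 1 1 = 0)"

text \<open>H_0^1((-1,1)) in one dimension: psi vanishes at +-1 and is the indefinite integral of an
  L^2 function w (its weak derivative).  We record pairs (psi, w).\<close>
definition H01 :: "((real \<Rightarrow> real) \<times> (real \<Rightarrow> real)) set" where
  "H01 = {(psi, w). set_integrable lborel {-1..1} w \<and>
                    set_integrable lborel {-1..1} (\<lambda>x. (w x)^2) \<and>
                    (\<forall>x\<in>{-1..1}. psi x = (LBINT t=-1..x. w t)) \<and>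
                    psi (-1) = 0 \<and> psi 1 = 0}"

definition H01_nonzero :: "((real \<Rightarrow> real) \<times> (real \<Rightarrow> real)) set" where
  "H01_nonzero = {(psi, w). (psi, w) \<in> H01 \<and> (\<exists>x\<in>{-1..1}. psi x \<noteq> 0)}"

definition Bc_sq :: "real \<Rightarrow> real \<Rightarrow> real \<Rightarrow> real" where
  "Bc_sq g rhop rhom = Sup {g * (rhop - rhom) * (psi 0)^2 / (LBINT x=-1..1. \<bar>w x\<bar>^2) | psi w.
                             (psi, w) \<in> H01_nonzero}"

definition Bc :: "real \<Rightarrow> real \<Rightarrow> real \<Rightarrow> real" where
  "Bc g rhop rhom = sqrt (Bc_sq g rhop rhom)"

definition xi_hc_sq :: "real \<Rightarrow> real \<Rightarrow> real \<Rightarrow> real \<Rightarrow> real" where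
  "xi_hc_sq g rhop rhom B = Sup {(g * (rhop - rhom) * (psi 0)^2 - \<bar>B\<bar>^2 * (LBINT x=-1..1. \<bar>w x\<bar>^2))
                                 / (\<bar>B\<bar>^2 * (LBINT x=-1..1. \<bar>psi x\<bar>^2)) | psi w.
                             (psi, w) \<in> H01_nonzero}"

definition xi_hc :: "real \<Rightarrow> real \<Rightarrow> real \<Rightarrow> real \<Rightarrow> real" where
  "xi_hc g rhop rhom B = sqrt (xi_hc_sq g rhop rhom B)"

end

theory Submission
  imports Defs
begin

text \<open>
  Testing the problem with its own solution gives the energy identity
  \<open>\<lambda>\<^sup>2\<integral>\<rho>(\<xi>\<^sup>2\<psi>\<^sup>2 + \<psi>'\<^sup>2) + \<lambda>\<integral>\<mu>((\<psi>'' + \<xi>\<^sup>2\<psi>)\<^sup>2 + 4\<xi>\<^sup>2\<psi>'\<^sup>2) = g[\<rho>]\<xi>\<^sup>2\<psi>(0)\<^sup>2 - B\<^sup>2\<xi>\<^sup>2\<integral>(\<xi>\<^sup>2\<psi>\<^sup>2 + \<psi>'\<^sup>2)\<close>,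
  whose right-hand side is nonpositive in cases (i) and (ii), so that \<open>\<psi> = 0\<close>.

  For (iii), replace the term \<open>g[\<rho>]\<xi>\<^sup>2\<psi>(0)\<close> of the last jump condition by a unit force. For every
  \<open>\<lambda> > 0\<close> the energy identity makes this linear problem (eight exponential coefficients, eight
  conditions) injective, hence solvable. Its solution \<open>\<psi>\<^sub>\<lambda>\<close> represents the evaluation at \<open>0\<close> with
  respect to the energy form \<open>E\<^sub>\<lambda>\<close>, i.e. \<open>E\<^sub>\<lambda>(\<psi>\<^sub>\<lambda>, \<phi>) = \<phi>(0)\<close>, so \<open>h(\<lambda>) = \<psi>\<^sub>\<lambda>(0)\<close> is the supremum of
  \<open>\<phi>(0)\<^sup>2 / E\<^sub>\<lambda>(\<phi>)\<close>. Therefore \<open>h\<close> is nonincreasing and \<open>\<lambda>\<^sup>2h(\<lambda>)\<close> is nondecreasing, which gives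
  continuity; \<open>h\<close> decays like \<open>\<lambda>\<^sup>-\<^sup>2\<close>, and for small \<open>\<lambda>\<close> it exceeds \<open>1/(g[\<rho>]\<xi>\<^sup>2)\<close> because
  \<open>|\<xi>| < |\<xi>|\<^sub>h\<^sub>c\<close>. Where \<open>h\<close> equals this value, \<open>\<psi>\<^sub>\<lambda>\<close> solves the original problem.
\<close>

section \<open>Trace inequalities in \<open>H01\<close>\<close>

text \<open>Fubini on the triangle \<open>t \<le> x\<close>. It replaces integration by parts for a
  function that is known only as the indefinite integral of an integrable \<open>w\<close>.\<close>

lemma set_integral_triangle_swap:
  fixes k w :: "real \<Rightarrow> real"
  assumes w: "set_integrable lborel {a..b} w" and k: "set_integrable lborel {a..b} k"
  shows "(LINT x:{a..b}|lborel. k x * (LINT t:{a..x}|lborel. w t)) =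
         (LINT t:{a..b}|lborel. w t * (LINT x:{t..b}|lborel. k x))"
proof -
  define K where "K x = indicator {a..b} x * k x" for x
  define W where "W x = indicator {a..b} x * w x" for x
  have iK: "integrable lborel K" and iW: "integrable lborel W"
    using w k by (auto simp: set_integrable_def K_def[abs_def] W_def[abs_def])
  have mK[measurable]: "K \<in> borel_measurable borel" and mW[measurable]: "W \<in> borel_measurable borel"
    using iK iW by auto
  have T: "closed {z::real \<times> real. snd z \<le> fst z}"
    by (intro closed_Collect_le continuous_intros)
  hence T'[measurable]: "{z::real \<times> real. snd z \<le> fst z} \<in> sets (borel \<Otimes>\<^sub>M borel)"
    unfolding borel_prod by (rule borel_closed)
  define F where "F z = K (fst z) * W (snd z) * indicator {z. snd z \<le> fst z} z" for z
  have mF: "F \<in> borel_measurable (lborel \<Otimes>\<^sub>M lborel)"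
    unfolding F_def by measurable
  have slice: "integrable lborel (\<lambda>t. F (x, t))" for x
  proof (rule Bochner_Integration.integrable_bound)
    show "integrable lborel (\<lambda>t. K x * W t)" using iW by simp
    show "(\<lambda>t. F (x, t)) \<in> borel_measurable lborel" 
      using measurable_Pair2[OF mF, of x] by simp
    show "AE t in lborel. norm (F (x,t)) \<le> norm (K x * W t)"
      by (auto simp: F_def indicator_def)
  qed
  have iF: "integrable (lborel \<Otimes>\<^sub>M lborel) F"
  proof (rule lborel_pair.Fubini_integrable)
    show "F \<in> borel_measurable (lborel \<Otimes>\<^sub>M lborel)" by (rule mF)
    show "integrable lborel (\<lambda>x. LINT y|lborel. norm (F (x, y)))"
    proof (rule Bochner_Integration.integrable_bound)
      show "integrable lborel (\<lambda>x. K x * (LINT t|lborel. \<bar>W t\<bar>))" using iK by simp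
      show "(\<lambda>x. LINT y|lborel. norm (F (x, y))) \<in> borel_measurable lborel"
        using mF by measurable
      have "norm (LINT y|lborel. norm (F (x, y))) \<le> norm (K x * (LINT t|lborel. \<bar>W t\<bar>))" for x
      proof -
        have "(LINT y|lborel. norm (F (x, y))) \<le> (LINT t|lborel. \<bar>K x\<bar> * \<bar>W t\<bar>)"
          by (intro integral_mono integrable_norm slice integrable_mult_right integrable_abs iW)
             (auto simp: F_def indicator_def abs_mult)
        thus ?thesis by (simp add: abs_mult)
      qed
      thus "AE x in lborel. norm (LINT y|lborel. norm (F (x, y))) \<le> norm (K x * (LINT t|lborel. \<bar>W t\<bar>))"
        by simp
    qed
    show "AE x in lborel. integrable lborel (\<lambda>y. F (x, y))" using slice by simp
  qed
  have "(LINT x:{a..b}|lborel. k x * (LINT t:{a..x}|lborel. w t)) = (LINT x|lborel. LINT t|lborel. F (x,t))"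
  proof -
    have "indicator {a..b} x *\<^sub>R (k x * (LINT t:{a..x}|lborel. w t)) = (LINT t|lborel. F (x,t))" for x
    proof -
      have "(LINT t|lborel. F (x,t)) = (LINT t|lborel. K x * (indicator {a..x} t * w t))"
        by (rule Bochner_Integration.integral_cong) (auto simp: F_def K_def W_def indicator_def)
      thus ?thesis by (simp add: K_def set_lebesgue_integral_def)
    qed
    thus ?thesis by (simp add: set_lebesgue_integral_def)
  qed
  also have "\<dots> = (LINT t|lborel. LINT x|lborel. F (x,t))"
    using lborel_pair.Fubini_integral[of "\<lambda>x t. F (x,t)"] iF by simp
  also have "\<dots> = (LINT t:{a..b}|lborel. w t * (LINT x:{t..b}|lborel. k x))"
  proof -
    have "indicator {a..b} t *\<^sub>R (w t * (LINT x:{t..b}|lborel. k x)) = (LINT x|lborel. F (x,t))" for t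
    proof -
      have "(LINT x|lborel. F (x,t)) = (LINT x|lborel. W t * (indicator {t..b} x * k x))"
        by (rule Bochner_Integration.integral_cong) (auto simp: F_def K_def W_def indicator_def)
      thus ?thesis by (simp add: W_def set_lebesgue_integral_def)
    qed
    thus ?thesis by (simp add: set_lebesgue_integral_def)
  qed
  finally show ?thesis .
qed

lemma set_integrable_mult_of_squares:
  fixes u v :: "'a \<Rightarrow> real"
  assumes "set_borel_measurable M S u" "set_borel_measurable M S v"
    and "set_integrable M S (\<lambda>x. (u x)\<^sup>2)" "set_integrable M S (\<lambda>x. (v x)\<^sup>2)"
  shows "set_integrable M S (\<lambda>x. u x * v x)"
  unfolding set_integrable_def
proof (rule Bochner_Integration.integrable_bound)
  show "integrable M (\<lambda>x. indicator S x *\<^sub>R (u x)\<^sup>2 + indicator S x *\<^sub>R (v x)\<^sup>2)"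
    using assms(3,4) by (auto simp: set_integrable_def)
  have "(\<lambda>x. (indicator S x *\<^sub>R u x) * (indicator S x *\<^sub>R v x)) \<in> borel_measurable M"
    using assms(1,2) unfolding set_borel_measurable_def by (rule borel_measurable_times)
  moreover have "(indicator S x *\<^sub>R u x) * (indicator S x *\<^sub>R v x) = indicator S x *\<^sub>R (u x * v x)" for x
    by (auto simp: indicator_def)
  ultimately show "(\<lambda>x. indicator S x *\<^sub>R (u x * v x)) \<in> borel_measurable M" by (simp only:)
  have "\<bar>a * b\<bar> \<le> \<bar>a\<^sup>2 + b\<^sup>2\<bar>" for a b :: real
  proof -
    have "0 \<le> (\<bar>a\<bar> - \<bar>b\<bar>)\<^sup>2" by simp
    hence "2 * (\<bar>a\<bar> * \<bar>b\<bar>) \<le> a\<^sup>2 + b\<^sup>2" by (simp add: power2_diff)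
    moreover have "0 \<le> \<bar>a\<bar> * \<bar>b\<bar>" by simp
    ultimately show ?thesis unfolding abs_mult by linarith
  qed
  thus "AE x in M. norm (indicator S x *\<^sub>R (u x * v x))
      \<le> norm (indicator S x *\<^sub>R (u x)\<^sup>2 + indicator S x *\<^sub>R (v x)\<^sup>2)"
    by (auto simp: indicator_def)
qed

text \<open>The exceptional set \<open>S\<close> serves antiderivatives that are defined piecewise
  and glued at \<open>0\<close>, where only continuity is left to check.\<close>

lemma set_integral_FTC_except:
  fixes f F :: "real \<Rightarrow> real"
  assumes "finite S" "a \<le> b" "set_integrable lborel {a..b} f" "continuous_on {a..b} F"
    and "\<And>x. x \<in> {a<..<b} - S \<Longrightarrow> (F has_real_derivative f x) (at x)"
  shows "(LINT x:{a..b}|lborel. f x) = F b - F a"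
proof -
  have "(f has_integral (F b - F a)) {a..b}"
    using assms by (intro fundamental_theorem_of_calculus_interior_strong[where S=S])
      (auto simp: has_real_derivative_iff_has_vector_derivative)
  thus ?thesis using set_borel_integral_eq_integral(2)[OF assms(3)] by (simp add: integral_unique)
qed

lemma H01_iff:
  "(psi, w) \<in> H01 \<longleftrightarrow> set_integrable lborel {-1..1} w \<and> set_integrable lborel {-1..1} (\<lambda>x. (w x)\<^sup>2) \<and>
     (\<forall>x\<in>{-1..1}. psi x = (LINT t:{-1..x}|lborel. w t)) \<and> psi (-1) = 0 \<and> psi 1 = 0"
proof -
  have "(LBINT t=-1..ereal x. w t) = (LINT t:{-1..x}|lborel. w t)" if "x \<in> {-1..1}" for x
    using interval_integral_Icc[of "-1" x w] that by (simp add: one_ereal_def)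
  thus ?thesis by (auto simp: H01_def)
qed

lemma LBINT_unit: "(LBINT x=-1..1. f x) = (LINT x:{-1..1}|lborel. (f x :: real))"
  using interval_integral_Icc[of "-1" 1 f] by (simp add: one_ereal_def)

lemma H01_continuous:
  assumes "(psi, w) \<in> H01"
  shows "continuous_on {-1..1} psi"
proof -
  have w: "set_integrable lborel {-1..1} w" and e: "\<And>x. x \<in> {-1..1} \<Longrightarrow> psi x = (LINT t:{-1..x}|lborel. w t)"
    using assms by (auto simp: H01_iff)
  have "psi x = integral {-1..x} w" if "x \<in> {-1..1}" for x
  proof -
    have "set_integrable lborel {-1..x} w" using w by (rule set_integrable_subset) (use that in auto)
    thus ?thesis using set_borel_integral_eq_integral(2) e that by metis
  qed
  moreover have "continuous_on {-1..1} (\<lambda>x. integral {-1..x} w)"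
    by (intro indefinite_integral_continuous_1 set_borel_integral_eq_integral w)
  ultimately show ?thesis by (metis (no_types, lifting) continuous_on_cong)
qed

lemma set_borel_measurable_of_integrable:
  "set_integrable M S f \<Longrightarrow> set_borel_measurable M S f"
  unfolding set_integrable_def set_borel_measurable_def by (rule borel_measurable_integrable)

text \<open>Integrate \<open>2 * c * w - c\<^sup>2 \<le> w\<^sup>2\<close> with
  \<open>c = psi 0\<close> over \<open>{-1..0}\<close>, which has length one. The constant is not
  sharp; the estimate serves to bound the supremum in \<open>Bc_sq\<close> and to treat vanishing
  denominators.\<close>

lemma H01_trace_le:
  assumes "(psi, w) \<in> H01"
  shows "(psi 0)\<^sup>2 \<le> (LINT x:{-1..1}|lborel. (w x)\<^sup>2)"
proof -
  have w: "set_integrable lborel {-1..1} w" "set_integrable lborel {-1..1} (\<lambda>x. (w x)\<^sup>2)"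
    and e: "psi 0 = (LINT t:{-1..0}|lborel. w t)"
    using assms by (auto simp: H01_iff)
  have w0: "set_integrable lborel {-1..0} w" "set_integrable lborel {-1..0} (\<lambda>x. (w x)\<^sup>2)"
    using w by (auto elim!: set_integrable_subset)
  have c: "set_integrable lborel {-1..0::real} (\<lambda>x. c)" for c :: real
    by (intro borel_integrable_atLeastAtMost' continuous_intros)
  define c where "c = psi 0"
  have "(LINT x:{-1..0}|lborel. 2 * c * w x - c\<^sup>2) \<le> (LINT x:{-1..0}|lborel. (w x)\<^sup>2)"
  proof (intro set_integral_mono set_integral_diff w0 c set_integrable_mult_right)
    show "2 * c * w x - c\<^sup>2 \<le> (w x)\<^sup>2" for x
      using zero_le_power2[of "w x - c"] by (simp add: power2_diff algebra_simps)
  qed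
  moreover have "(LINT x:{-1..0}|lborel. 2 * c * w x - c\<^sup>2) = c\<^sup>2"
    by (subst set_integral_diff(2)) (auto intro!: w0 c simp: e[symmetric] c_def power2_eq_square set_integral_const)
  moreover have "(LINT x:{-1..0}|lborel. (w x)\<^sup>2) \<le> (LINT x:{-1..1}|lborel. (w x)\<^sup>2)"
    unfolding set_lebesgue_integral_def
    by (intro integral_mono w(2)[unfolded set_integrable_def] w0(2)[unfolded set_integrable_def])
       (auto simp: indicator_def)
  ultimately show ?thesis by (simp add: c_def)
qed

text \<open>Completing the square with the minimiser \<open>sinh (s (1 - |x|))\<close> of the right-hand side.\<close>
lemma H01_trace_le_energy:
  assumes "(psi, w) \<in> H01" and s: "s > 0"
  shows "2 * s * cosh s * (psi 0)\<^sup>2 \<le>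
     sinh s * ((LINT x:{-1..1}|lborel. (w x)\<^sup>2) + s\<^sup>2 * (LINT x:{-1..1}|lborel. (psi x)\<^sup>2))"
proof -
  let ?I = "\<lambda>f. (LINT x:{-1..1}|lborel. (f x :: real))"
  have w: "set_integrable lborel {-1..1} w" "set_integrable lborel {-1..1} (\<lambda>x. (w x)\<^sup>2)"
    and e: "\<And>x. x \<in> {-1..1} \<Longrightarrow> psi x = (LINT t:{-1..x}|lborel. w t)" and p1: "psi 1 = 0"
    using assms by (auto simp: H01_iff)
  note cont = H01_continuous[OF assms(1)]
  have ci: "continuous_on {-1..1} f \<Longrightarrow> set_integrable lborel {-1..1} f" for f :: "real \<Rightarrow> real"
    by (rule borel_integrable_atLeastAtMost')
  \<comment> \<open>\<open>G\<close> is the minimiser. Its derivative \<open>G'\<close> jumps at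
    \<open>0\<close> by \<open>- 2 * s * cosh s\<close>; \<open>J\<close> carries this jump, and
    \<open>P\<close> is the continuous rest, with derivative \<open>s\<^sup>2 * G\<close> away from
    \<open>0\<close>.\<close>
  define G where "G x = sinh (s * (1 - \<bar>x\<bar>))" for x
  define P where "P x = s * cosh (s * (1 + min x 0)) - s * cosh (s * (1 - max x 0)) - s * cosh s" for x
  define J :: "real \<Rightarrow> real" where "J x = 2 * s * cosh s * indicator {-1..0} x" for x
  define G' where "G' x = P x + J x" for x
  have cG: "continuous_on A G" for A unfolding G_def by (intro continuous_intros)
  have cP: "continuous_on A P" for A unfolding P_def by (intro continuous_intros)
  have iJ: "set_integrable lborel {-1..1} J"
  proof -
    have "set_integrable lborel {-1..0::real} (\<lambda>x. 2 * s * cosh s)"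
      by (intro borel_integrable_atLeastAtMost' continuous_intros)
    thus ?thesis unfolding set_integrable_def J_def
      by (rule Bochner_Integration.integrable_cong[THEN iffD1, rotated -1]) (auto simp: indicator_def)
  qed
  have iG': "set_integrable lborel {-1..1} G'"
    unfolding G'_def[abs_def] by (intro set_integral_add ci cP iJ)
  have G'_abs: "G' x = (if x \<le> 0 then s * cosh (s * (1 + x)) else - s * cosh (s * (1 - x)))" if "x \<in> {-1..1}" for x
    using that by (auto simp: G'_def P_def J_def)
  have G'_sq: "(G' x)\<^sup>2 = (s * cosh (s * (1 - \<bar>x\<bar>)))\<^sup>2" if "x \<in> {-1..1}" for x
    using that by (auto simp: G'_abs)
  have iG'2: "set_integrable lborel {-1..1} (\<lambda>x. (G' x)\<^sup>2)"
  proof -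
    have "set_integrable lborel {-1..1} (\<lambda>x. (s * cosh (s * (1 - \<bar>x\<bar>)))\<^sup>2)"
      by (intro ci continuous_intros)
    thus ?thesis by (rule set_integrable_cong[THEN iffD1, rotated -1]) (auto simp: G'_sq)
  qed
  have ipsi2: "set_integrable lborel {-1..1} (\<lambda>x. (psi x)\<^sup>2)" by (intro ci continuous_intros cont)
  have ipsiG: "set_integrable lborel {-1..1} (\<lambda>x. psi x * G x)" by (intro ci continuous_intros cont cG)
  have iG2: "set_integrable lborel {-1..1} (\<lambda>x. (G x)\<^sup>2)" by (intro ci continuous_intros cont cG)
  have iwG': "set_integrable lborel {-1..1} (\<lambda>x. w x * G' x)"
    by (intro set_integrable_mult_of_squares set_borel_measurable_of_integrable w iG' iG'2)
  have iwP: "set_integrable lborel {-1..1} (\<lambda>x. w x * P x)"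
    by (intro set_integrable_mult_of_squares set_borel_measurable_of_integrable w ci cP continuous_intros)
  have iwJ: "set_integrable lborel {-1..1} (\<lambda>x. w x * J x)"
    using set_integral_diff(1)[OF iwG' iwP] by (simp add: G'_def algebra_simps)
  have tail: "(LINT x:{t..1}|lborel. s\<^sup>2 * G x) = - s - P t" if "t \<in> {-1..1}" for t
  proof -
    have "(LINT x:{t..1}|lborel. s\<^sup>2 * G x) = P 1 - P t"
    proof (rule set_integral_FTC_except[where S = "{0}"])
      fix x assume x: "x \<in> {t<..<1} - {0::real}"
      show "(P has_real_derivative s\<^sup>2 * G x) (at x)"
      proof (cases "x < 0")
        case True
        have "((\<lambda>x. s * cosh (s * (1 + x)) - s * cosh s - s * cosh s) has_real_derivative s\<^sup>2 * G x) (at x)"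
          using True by (auto intro!: derivative_eq_intros simp: G_def power2_eq_square)
        thus ?thesis by (rule has_field_derivative_transform_within_open[where S = "{..<0}"])
           (use True in \<open>auto simp: P_def\<close>)
      next
        case False
        have "((\<lambda>x. s * cosh s - s * cosh (s * (1 - x)) - s * cosh s) has_real_derivative s\<^sup>2 * G x) (at x)"
          using False by (auto intro!: derivative_eq_intros simp: G_def power2_eq_square)
        thus ?thesis by (rule has_field_derivative_transform_within_open[where S = "{0<..}"])
           (use False x in \<open>auto simp: P_def\<close>)
      qed
    qed (use that in \<open>auto intro!: cP borel_integrable_atLeastAtMost' continuous_intros cG\<close>)
    thus ?thesis by (simp add: P_def)
  qed
  \<comment> \<open>Swapping the order of integration moves the integral from \<open>psi\<close> to
    \<open>G\<close>. The constant \<open>P 1 = - s\<close> then multiplies the integral of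
    \<open>w\<close>, which is \<open>psi 1 = 0\<close>.\<close>
  have "s\<^sup>2 * ?I (\<lambda>x. psi x * G x) = ?I (\<lambda>x. (s\<^sup>2 * G x) * (LINT t:{-1..x}|lborel. w t))"
    unfolding set_integral_mult_right[symmetric]
    by (rule set_lebesgue_integral_cong) (auto simp: e)
  also have "\<dots> = ?I (\<lambda>t. w t * (LINT x:{t..1}|lborel. s\<^sup>2 * G x))"
    by (intro set_integral_triangle_swap w ci continuous_intros cG)
  also have "\<dots> = ?I (\<lambda>t. (- s) * w t - w t * P t)"
    by (rule set_lebesgue_integral_cong) (auto simp: tail right_diff_distrib simp del: set_integral_mult_right)
  also have "\<dots> = ?I (\<lambda>t. (- s) * w t) - ?I (\<lambda>t. w t * P t)"
    by (intro set_integral_diff(2) set_integrable_mult_right w iwP)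
  also have "?I (\<lambda>t. (- s) * w t) = (- s) * ?I w"
    by (rule set_integral_mult_right)
  also have "?I w = 0" using e[of 1] p1 by simp
  finally have 1: "s\<^sup>2 * ?I (\<lambda>x. psi x * G x) = - ?I (\<lambda>t. w t * P t)" by simp
  have "?I (\<lambda>x. w x * J x) = (LINT x:{-1..0}|lborel. (2 * s * cosh s) * w x)"
    unfolding set_lebesgue_integral_def J_def
    by (rule Bochner_Integration.integral_cong) (auto simp: indicator_def)
  also have "\<dots> = 2 * s * cosh s * psi 0" using e[of 0] by simp
  finally have "?I (\<lambda>x. w x * G' x) = ?I (\<lambda>t. w t * P t) + 2 * s * cosh s * psi 0"
    using set_integral_add(2)[OF iwP iwJ] by (simp add: G'_def algebra_simps)
  \<comment> \<open>Weak form of \<open>G'' = s\<^sup>2 G - 2 s cosh s \<delta>\<close>: only the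
    jump survives, so pairing with \<open>G\<close> evaluates \<open>psi\<close> at
    \<open>0\<close>.\<close>
  hence cross: "?I (\<lambda>x. w x * G' x) + s\<^sup>2 * ?I (\<lambda>x. psi x * G x) = 2 * s * cosh s * psi 0"
    using 1 by simp
  have "?I (\<lambda>x. (G' x)\<^sup>2) + s\<^sup>2 * ?I (\<lambda>x. (G x)\<^sup>2) = ?I (\<lambda>x. (G' x)\<^sup>2 + s\<^sup>2 * (G x)\<^sup>2)"
    by (subst set_integral_add(2)) (auto intro!: iG'2 iG2)
  also have "\<dots> = ?I (\<lambda>x. s\<^sup>2 * ((cosh (s * (1 - \<bar>x\<bar>)))\<^sup>2 + (sinh (s * (1 - \<bar>x\<bar>)))\<^sup>2))"
    by (rule set_lebesgue_integral_cong) (auto simp: G'_sq G_def power_mult_distrib algebra_simps)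
  also have "\<dots> = 2 * s * sinh s * cosh s"
  proof -
    \<comment> \<open>An antiderivative on each side of \<open>0\<close>, shifted so that both
      branches vanish at \<open>0\<close>.\<close>
    define Q where "Q x = s * sinh (s * (1 + min x 0)) * cosh (s * (1 + min x 0))
       - s * sinh (s * (1 - max x 0)) * cosh (s * (1 - max x 0))" for x
    have "?I (\<lambda>x. s\<^sup>2 * ((cosh (s * (1 - \<bar>x\<bar>)))\<^sup>2 + (sinh (s * (1 - \<bar>x\<bar>)))\<^sup>2)) = Q 1 - Q (-1)"
    proof (rule set_integral_FTC_except[where S = "{0}"])
      fix x assume x: "x \<in> {-1<..<1} - {0::real}"
      show "(Q has_real_derivative s\<^sup>2 * ((cosh (s * (1 - \<bar>x\<bar>)))\<^sup>2 + (sinh (s * (1 - \<bar>x\<bar>)))\<^sup>2)) (at x)"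
      proof (cases "x < 0")
        case True
        have "((\<lambda>x. s * sinh (s * (1 + x)) * cosh (s * (1 + x)) - s * sinh s * cosh s) has_real_derivative
            s\<^sup>2 * ((cosh (s * (1 - \<bar>x\<bar>)))\<^sup>2 + (sinh (s * (1 - \<bar>x\<bar>)))\<^sup>2)) (at x)"
          using True by (auto intro!: derivative_eq_intros simp: power2_eq_square algebra_simps)
        thus ?thesis by (rule has_field_derivative_transform_within_open[where S = "{..<0}"])
           (use True in \<open>auto simp: Q_def\<close>)
      next
        case False
        have "((\<lambda>x. s * sinh s * cosh s - s * sinh (s * (1 - x)) * cosh (s * (1 - x))) has_real_derivative
            s\<^sup>2 * ((cosh (s * (1 - \<bar>x\<bar>)))\<^sup>2 + (sinh (s * (1 - \<bar>x\<bar>)))\<^sup>2)) (at x)"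
          using False by (auto intro!: derivative_eq_intros simp: power2_eq_square algebra_simps)
        thus ?thesis by (rule has_field_derivative_transform_within_open[where S = "{0<..}"])
           (use False x in \<open>auto simp: Q_def\<close>)
      qed
    qed (auto intro!: ci continuous_intros simp: Q_def[abs_def])
    thus ?thesis by (simp add: Q_def)
  qed
  finally have norm_G: "?I (\<lambda>x. (G' x)\<^sup>2) + s\<^sup>2 * ?I (\<lambda>x. (G x)\<^sup>2) = 2 * s * sinh s * cosh s" .
  \<comment> \<open>The coefficient of the orthogonal projection onto \<open>G\<close>, namely
    \<open>cross\<close> divided by \<open>norm_G\<close>.\<close>
  define c where "c = psi 0 / sinh s"
  have sh: "sinh s > 0" using s by simp
  have expand: "?I (\<lambda>x. (u x - c * v x)\<^sup>2) = ?I (\<lambda>x. (u x)\<^sup>2) - 2 * c * ?I (\<lambda>x. u x * v x) + c\<^sup>2 * ?I (\<lambda>x. (v x)\<^sup>2)"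
    if "set_integrable lborel {-1..1} (\<lambda>x. (u x)\<^sup>2)" "set_integrable lborel {-1..1} (\<lambda>x. u x * v x)"
      "set_integrable lborel {-1..1} (\<lambda>x. (v x)\<^sup>2)" for u v :: "real \<Rightarrow> real"
  proof -
    have "?I (\<lambda>x. (u x - c * v x)\<^sup>2) = ?I (\<lambda>x. ((u x)\<^sup>2 - (2 * c) * (u x * v x)) + c\<^sup>2 * (v x)\<^sup>2)"
      by (rule set_lebesgue_integral_cong) (auto simp: power2_eq_square algebra_simps)
    also have "\<dots> = ?I (\<lambda>x. (u x)\<^sup>2) - 2 * c * ?I (\<lambda>x. u x * v x) + c\<^sup>2 * ?I (\<lambda>x. (v x)\<^sup>2)"
      using that by (simp add: set_integral_add set_integral_diff set_integrable_mult_right)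
    finally show ?thesis .
  qed
  have nonneg: "0 \<le> ?I (\<lambda>x. (f x)\<^sup>2)" for f
    unfolding set_lebesgue_integral_def by (rule Bochner_Integration.integral_nonneg) simp
  have "0 \<le> ?I (\<lambda>x. (w x - c * G' x)\<^sup>2) + s\<^sup>2 * ?I (\<lambda>x. (psi x - c * G x)\<^sup>2)"
    by (intro add_nonneg_nonneg mult_nonneg_nonneg nonneg zero_le_power2)
  also have "\<dots> = ?I (\<lambda>x. (w x)\<^sup>2) + s\<^sup>2 * ?I (\<lambda>x. (psi x)\<^sup>2)
      - 2 * c * (?I (\<lambda>x. w x * G' x) + s\<^sup>2 * ?I (\<lambda>x. psi x * G x))
      + c\<^sup>2 * (?I (\<lambda>x. (G' x)\<^sup>2) + s\<^sup>2 * ?I (\<lambda>x. (G x)\<^sup>2))"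
    unfolding expand[OF w(2) iwG' iG'2] expand[OF ipsi2 ipsiG iG2] by (simp add: algebra_simps)
  also have "\<dots> = ?I (\<lambda>x. (w x)\<^sup>2) + s\<^sup>2 * ?I (\<lambda>x. (psi x)\<^sup>2) - 2 * s * cosh s * (psi 0)\<^sup>2 / sinh s"
    unfolding cross norm_G c_def using sh by (simp add: field_simps power2_eq_square)
  finally show ?thesis using sh by (simp add: field_simps)
qed

section \<open>The energy form\<close>

text \<open>The weak form involves at most second derivatives of a test function. Derivatives are
  taken within \<open>S\<close>, hence one-sided at the end points of an interval.\<close>

definition C2_family :: "real set \<Rightarrow> (nat \<Rightarrow> real \<Rightarrow> real) \<Rightarrow> bool" where
  "C2_family S f \<longleftrightarrow> (\<forall>k<2. \<forall>x\<in>S. (f k has_real_derivative f (Suc k) x) (at x within S)) \<and>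
     continuous_on S (f 2)"

lemma C2_family_continuous:
  assumes "C2_family S f" "k \<le> 2"
  shows "continuous_on S (f k)"
proof (cases "k = 2")
  case False
  hence "k < 2" using assms by simp
  thus ?thesis using assms(1) unfolding C2_family_def
    by (meson DERIV_continuous continuous_on_eq_continuous_within)
qed (use assms in \<open>simp add: C2_family_def\<close>)

lemma C2_family_derivatives:
  assumes "C2_family S f" "x \<in> S"
  shows "(f 0 has_real_derivative f 1 x) (at x within S)" "(f 1 has_real_derivative f 2 x) (at x within S)"
  using assms unfolding C2_family_def by (auto simp: eval_nat_numeral)

text \<open>Cauchy-Schwarz through \<open>2 * c * f' - c\<^sup>2 \<le> f'\<^sup>2\<close> with
  \<open>c\<close> the increment; the length \<open>y - x\<close> is absorbed by
  \<open>b - a \<le> 1\<close>.\<close>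

lemma square_increment_le:
  assumes "\<And>x. x \<in> {a..b} \<Longrightarrow> (f has_real_derivative f' x) (at x within {a..b})"
    and "continuous_on {a..b} f'" and "a \<le> x" "x \<le> y" "y \<le> b" "b - a \<le> 1"
  shows "(f y - f x)\<^sup>2 \<le> integral {a..b} (\<lambda>z. (f' z)\<^sup>2)"
proof -
  define c where "c = f y - f x"
  have sub: "{x..y} \<subseteq> {a..b}" using assms by auto
  have ii: "(f' has_integral c) {x..y}"
    unfolding c_def
    by (rule fundamental_theorem_of_calculus[OF \<open>x \<le> y\<close>])
      (use sub in \<open>auto simp: has_real_derivative_iff_has_vector_derivative[symmetric]
        intro!: has_field_derivative_subset[OF assms(1)]\<close>)
  have cont: "continuous_on {a..b} (\<lambda>z. (f' z)\<^sup>2)" by (intro continuous_intros assms)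
  have "((\<lambda>z. 2 * c * f' z - c\<^sup>2) has_integral (2 * c * c - c\<^sup>2 * (y - x))) {x..y}"
    using has_integral_diff[OF has_integral_mult_right[OF ii, of "2 * c"] has_integral_const_real[of "c\<^sup>2" x y]]
      \<open>x \<le> y\<close> by (simp add: mult.commute)
  moreover have "((\<lambda>z. (f' z)\<^sup>2) has_integral integral {x..y} (\<lambda>z. (f' z)\<^sup>2)) {x..y}"
    by (intro integrable_integral integrable_continuous_interval continuous_on_subset[OF cont sub])
  ultimately have "2 * c * c - c\<^sup>2 * (y - x) \<le> integral {x..y} (\<lambda>z. (f' z)\<^sup>2)"
  proof (rule has_integral_le)
    show "2 * c * f' z - c\<^sup>2 \<le> (f' z)\<^sup>2" for z
      using zero_le_power2[of "f' z - c"] by (simp add: power2_diff algebra_simps)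
  qed
  also have "\<dots> \<le> integral {a..b} (\<lambda>z. (f' z)\<^sup>2)"
    by (rule integral_subset_le[OF sub])
       (auto intro!: integrable_continuous_interval cont continuous_on_subset[OF cont sub])
  finally have "2 * c * c - c\<^sup>2 * (y - x) \<le> integral {a..b} (\<lambda>z. (f' z)\<^sup>2)" .
  moreover have "c\<^sup>2 * (y - x) \<le> c\<^sup>2 * 1" using assms by (intro mult_left_mono) auto
  moreover have "2 * c * c = 2 * c\<^sup>2" by (simp add: power2_eq_square)
  ultimately have "c\<^sup>2 \<le> integral {a..b} (\<lambda>z. (f' z)\<^sup>2)" by linarith
  thus ?thesis by (simp add: c_def)
qed

text \<open>A nonintegrable square has integral \<open>0\<close> by convention, so the bound is
  unconditional.\<close>

lemma integral_square_nonneg: "0 \<le> integral S (\<lambda>x. (h x :: real)\<^sup>2)"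
  by (cases "(\<lambda>x. (h x)\<^sup>2) integrable_on S") (auto intro!: integral_nonneg simp: not_integrable_integral)

text \<open>Below, a family \<open>f\<close> lists a function and its derivatives: \<open>f k\<close> stands for the \<open>k\<close>-th derivative.
  The flux is chosen so that its derivative is the energy density minus the ODE residual times \<open>p 0\<close>.\<close>
definition energy_density ::
  "real \<Rightarrow> real \<Rightarrow> real \<Rightarrow> real \<Rightarrow> real \<Rightarrow> (nat \<Rightarrow> real \<Rightarrow> real) \<Rightarrow> (nat \<Rightarrow> real \<Rightarrow> real) \<Rightarrow> real \<Rightarrow> real" where
  "energy_density r m \<beta> \<xi> la f p x =
     la\<^sup>2 * r * (\<xi>\<^sup>2 * f 0 x * p 0 x + f 1 x * p 1 x)
     + la * m * ((f 2 x + \<xi>\<^sup>2 * f 0 x) * (p 2 x + \<xi>\<^sup>2 * p 0 x) + 4 * \<xi>\<^sup>2 * f 1 x * p 1 x)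
     + \<beta> * \<xi>\<^sup>2 * (\<xi>\<^sup>2 * f 0 x * p 0 x + f 1 x * p 1 x)"

definition ode_residual ::
  "real \<Rightarrow> real \<Rightarrow> real \<Rightarrow> real \<Rightarrow> real \<Rightarrow> (nat \<Rightarrow> real \<Rightarrow> real) \<Rightarrow> real \<Rightarrow> real" where
  "ode_residual r m \<beta> \<xi> la f x =
     m * la * (\<xi>^4 * f 0 x - 2 * \<xi>\<^sup>2 * f 2 x + f 4 x) + \<beta> * (\<xi>^4 * f 0 x - \<xi>\<^sup>2 * f 2 x)
     + la\<^sup>2 * r * (\<xi>\<^sup>2 * f 0 x - f 2 x)"

definition flux ::
  "real \<Rightarrow> real \<Rightarrow> real \<Rightarrow> real \<Rightarrow> real \<Rightarrow> (nat \<Rightarrow> real \<Rightarrow> real) \<Rightarrow> (nat \<Rightarrow> real \<Rightarrow> real) \<Rightarrow> real \<Rightarrow> real" where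
  "flux r m \<beta> \<xi> la f p x =
     la\<^sup>2 * r * f 1 x * p 0 x
     + la * m * ((f 2 x + \<xi>\<^sup>2 * f 0 x) * p 1 x - (f 3 x - 3 * \<xi>\<^sup>2 * f 1 x) * p 0 x)
     + \<beta> * \<xi>\<^sup>2 * f 1 x * p 0 x"

lemma energy_density_integrable:
  assumes "C2_family {a..b} f" "C2_family {a..b} p"
  shows "energy_density r m \<beta> \<xi> la f p integrable_on {a..b}"
proof -
  have "continuous_on {a..b} (\<lambda>x. energy_density r m \<beta> \<xi> la f p x)"
    unfolding energy_density_def
    by (intro continuous_intros C2_family_continuous[OF assms(1)] C2_family_continuous[OF assms(2)]) auto
  thus ?thesis using integrable_continuous_interval by blast
qed

lemma energy_density_nonneg:
  "r \<ge> 0 \<Longrightarrow> m \<ge> 0 \<Longrightarrow> \<beta> \<ge> 0 \<Longrightarrow> la \<ge> 0 \<Longrightarrow> energy_density r m \<beta> z la f f x \<ge> 0"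
  unfolding energy_density_def mult.assoc power2_eq_square[of "f _ _", symmetric]
    power2_eq_square[of "f _ _ + _", symmetric]
  by (intro add_nonneg_nonneg mult_nonneg_nonneg) auto

text \<open>All integrations by parts behind the weak form, packed into one antiderivative. Since
  \<open>flux\<close> is continuous up to the end points, the equation is used in the open interval
  only.\<close>

lemma energy_density_has_integral_flux:
  assumes f: "\<And>k x. k < 4 \<Longrightarrow> x \<in> {a..b} \<Longrightarrow> (f k has_real_derivative f (Suc k) x) (at x within {a..b})"
    and p: "C2_family {a..b} p" and "a \<le> b"
    and ode: "\<And>x. x \<in> {a<..<b} \<Longrightarrow> ode_residual r m \<beta> \<xi> la f x = 0"
  shows "(energy_density r m \<beta> \<xi> la f p has_integral
           (flux r m \<beta> \<xi> la f p b - flux r m \<beta> \<xi> la f p a)) {a..b}"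
proof (rule fundamental_theorem_of_calculus_interior[OF \<open>a \<le> b\<close>])
  have cf: "continuous_on {a..b} (f k)" if "k < 4" for k
    using f[OF that] by (meson DERIV_continuous continuous_on_eq_continuous_within)
  show "continuous_on {a..b} (\<lambda>x. flux r m \<beta> \<xi> la f p x)"
    unfolding flux_def by (intro continuous_intros cf C2_family_continuous[OF p]) auto
  fix x assume x: "x \<in> {a<..<b}"
  have df: "(f k has_real_derivative f (Suc k) x) (at x)" if "k < 4" for k
    using f[OF that, of x] x by (simp add: at_within_Icc_at)
  have dp: "(p 0 has_real_derivative p 1 x) (at x)" "(p 1 has_real_derivative p 2 x) (at x)"
    using C2_family_derivatives[OF p, of x] x by (auto simp: at_within_Icc_at)
  have d0: "(f 0 has_real_derivative f 1 x) (at x)" using df[of 0] by simp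
  have d1: "(f 1 has_real_derivative f 2 x) (at x)" using df[of 1] by (simp add: eval_nat_numeral)
  have d2: "(f 2 has_real_derivative f 3 x) (at x)" using df[of 2] by (simp add: eval_nat_numeral)
  have d3: "(f 3 has_real_derivative f 4 x) (at x)" using df[of 3] by (simp add: eval_nat_numeral)
  have "((\<lambda>x. flux r m \<beta> \<xi> la f p x) has_real_derivative
      energy_density r m \<beta> \<xi> la f p x - ode_residual r m \<beta> \<xi> la f x * p 0 x) (at x)"
    unfolding flux_def
    by (rule derivative_eq_intros refl d0 d1 d2 d3 dp)+
      (simp add: energy_density_def ode_residual_def algebra_simps power2_eq_square power4_eq_xxxx)
  thus "((\<lambda>x. flux r m \<beta> \<xi> la f p x) has_vector_derivative energy_density r m \<beta> \<xi> la f p x) (at x)"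
    using ode[OF x] by (simp add: has_real_derivative_iff_has_vector_derivative)
qed

text \<open>A function of class \<open>H\<^sub>0\<^sup>2\<close> that is \<open>C\<^sup>2\<close> on
  either side of the interface, given by its two restrictions; second derivatives may jump at
  \<open>0\<close>.\<close>

definition test_pair :: "(nat \<Rightarrow> real \<Rightarrow> real) \<Rightarrow> (nat \<Rightarrow> real \<Rightarrow> real) \<Rightarrow> bool" where
  "test_pair fL fR \<longleftrightarrow> C2_family {-1..0} fL \<and> C2_family {0..1} fR \<and>
     fL 0 0 = fR 0 0 \<and> fL 1 0 = fR 1 0 \<and>
     fL 0 (-1) = 0 \<and> fL 1 (-1) = 0 \<and> fR 0 1 = 0 \<and> fR 1 1 = 0"

text \<open>Makes a solution a competitor in the two suprema: the one-sided first derivatives are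
  glued into a weak derivative, and the norms become the integrals occurring in
  \<open>static_energy\<close>.\<close>

lemma test_pair_H01:
  assumes "test_pair fL fR" and L: "\<And>x. x \<in> {-1..0} \<Longrightarrow> fL 0 x = psi x"
    and R: "\<And>x. x \<in> {0..1} \<Longrightarrow> fR 0 x = psi x"
  defines "w \<equiv> \<lambda>x. if x \<le> 0 then fL 1 x else fR 1 x"
  shows "(psi, w) \<in> H01"
    and "(LINT x:{-1..1}|lborel. (w x)\<^sup>2) = integral {-1..0} (\<lambda>x. (fL 1 x)\<^sup>2) + integral {0..1} (\<lambda>x. (fR 1 x)\<^sup>2)"
    and "(LINT x:{-1..1}|lborel. (psi x)\<^sup>2) = integral {-1..0} (\<lambda>x. (fL 0 x)\<^sup>2) + integral {0..1} (\<lambda>x. (fR 0 x)\<^sup>2)"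
proof -
  have CL: "C2_family {-1..0} fL" and CR: "C2_family {0..1} fR"
    and j: "fL 1 0 = fR 1 0" "fL 0 0 = fR 0 0" and bc: "fL 0 (-1) = 0" "fR 0 1 = 0"
    using assms(1) by (auto simp: test_pair_def)
  have U: "{-1..1::real} = {-1..0} \<union> {0..1}" by auto
  have cw: "continuous_on {-1..1} w" unfolding w_def U
    by (rule continuous_on_If) (auto intro: C2_family_continuous[OF CL] C2_family_continuous[OF CR] simp: j[simplified])
  have cp: "continuous_on {-1..1} psi"
    unfolding U
    by (rule continuous_on_closed_Un)
       (use L R in \<open>auto intro: continuous_on_eq[OF C2_family_continuous[OF CL, of 0]]
          continuous_on_eq[OF C2_family_continuous[OF CR, of 0]]\<close>)
  have wL: "w x = fL 1 x" if "x \<in> {-1..0}" for x using that by (simp add: w_def)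
  have wR: "w x = fR 1 x" if "x \<in> {0..1}" for x using that j by (auto simp: w_def)
  have psi_int: "psi x = (LINT t:{-1..x}|lborel. w t)" if "x \<in> {-1..1}" for x
  proof -
    have "(LINT t:{-1..x}|lborel. w t) = psi x - psi (-1)"
    proof (rule set_integral_FTC_except[where S="{0}"])
      fix y assume y: "y \<in> {-1<..<x} - {0}"
      show "(psi has_real_derivative w y) (at y)"
      proof (cases "y < 0")
        case True
        hence "(fL 0 has_real_derivative fL 1 y) (at y)"
          using C2_family_derivatives(1)[OF CL, of y] y by (simp add: at_within_Icc_at)
        thus ?thesis using True y
          by (auto intro!: has_field_derivative_transform_within_open[of "fL 0" _ _ "{-1<..<0}" psi] simp: L wL)
      next
        case False
        hence "(fR 0 has_real_derivative fR 1 y) (at y)"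
          using C2_family_derivatives(1)[OF CR, of y] y that by (simp add: at_within_Icc_at)
        thus ?thesis using False y that
          by (auto intro!: has_field_derivative_transform_within_open[of "fR 0" _ _ "{0<..<1}" psi] simp: R wR)
      qed
    qed (use that in \<open>auto intro!: borel_integrable_atLeastAtMost' continuous_on_subset[OF cw] continuous_on_subset[OF cp]\<close>)
    thus ?thesis using L[of "-1"] bc by simp
  qed
  have iw: "set_integrable lborel {-1..1} w" "set_integrable lborel {-1..1} (\<lambda>x. (w x)\<^sup>2)"
    by (intro borel_integrable_atLeastAtMost' continuous_intros cw)+
  show "(psi, w) \<in> H01"
    unfolding H01_iff using iw psi_int L[of "-1"] R[of 1] bc by auto
  have split: "(LINT x:{-1..1}|lborel. h x) = integral {-1..0} u + integral {0..1} v"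
    if "continuous_on {-1..1} h" "\<And>x. x \<in> {-1..0} \<Longrightarrow> h x = u x" "\<And>x. x \<in> {0..1} \<Longrightarrow> h x = v x"
    for h u v :: "real \<Rightarrow> real"
  proof -
    have "(LINT x:{-1..1}|lborel. h x) = integral {-1..1} h"
      by (intro set_borel_integral_eq_integral borel_integrable_atLeastAtMost' that)
    also have "\<dots> = integral {-1..0} h + integral {0..1} h"
      by (rule Henstock_Kurzweil_Integration.integral_combine[symmetric]) (auto intro: integrable_continuous_interval that)
    also have "integral {-1..0} h = integral {-1..0} u" using that by (intro integral_cong) auto
    also have "integral {0..1} h = integral {0..1} v" using that by (intro integral_cong) auto
    finally show ?thesis .
  qed
  show "(LINT x:{-1..1}|lborel. (w x)\<^sup>2) = integral {-1..0} (\<lambda>x. (fL 1 x)\<^sup>2) + integral {0..1} (\<lambda>x. (fR 1 x)\<^sup>2)"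
    by (rule split) (auto intro!: continuous_intros cw simp: wL wR)
  show "(LINT x:{-1..1}|lborel. (psi x)\<^sup>2) = integral {-1..0} (\<lambda>x. (fL 0 x)\<^sup>2) + integral {0..1} (\<lambda>x. (fR 0 x)\<^sup>2)"
    by (rule split) (auto intro!: continuous_intros cp simp: L R)
qed

section \<open>The two-layer slab: weak form and energy estimates\<close>

locale slab =
  fixes rhop rhom mup mum B \<xi> :: real
  assumes rho_pos: "rhop > 0" "rhom > 0" and mu_pos: "mup > 0" "mum > 0"
begin

definition energy where
  "energy la fL fR pL pR = integral {-1..0} (energy_density rhom mum (B\<^sup>2) \<xi> la fL pL)
     + integral {0..1} (energy_density rhop mup (B\<^sup>2) \<xi> la fR pR)"

text \<open>What is left of the quadratic form \<open>energy\<close> at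
  \<open>\<lambda> = 0\<close>; instability means that gravity exceeds it for some test
  pair.\<close>

definition static_energy where
  "static_energy pL pR = B\<^sup>2 * \<xi>\<^sup>2 * (\<xi>\<^sup>2 * (integral {-1..0} (\<lambda>x. (pL 0 x)\<^sup>2) + integral {0..1} (\<lambda>x. (pR 0 x)\<^sup>2))
        + (integral {-1..0} (\<lambda>x. (pL 1 x)\<^sup>2) + integral {0..1} (\<lambda>x. (pR 1 x)\<^sup>2)))"

lemma static_energy_nonneg: "0 \<le> static_energy pL pR"
  unfolding static_energy_def
  by (intro mult_nonneg_nonneg add_nonneg_nonneg integral_square_nonneg) auto

lemma energy_nonneg:
  assumes "la > 0" "test_pair pL pR"
  shows "0 \<le> energy la pL pR pL pR"
  unfolding energy_def
  by (intro add_nonneg_nonneg integral_nonneg energy_density_integrable energy_density_nonneg)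
     (use assms rho_pos mu_pos in \<open>auto simp: test_pair_def\<close>)

text \<open>For \<open>F = g * (rhop - rhom) * \<xi>\<^sup>2 * fR 0 0\<close> these are the
  equations of the original problem; a prescribed \<open>F\<close> makes the system
  inhomogeneous.\<close>

definition forced_mode where
  "forced_mode la F fL fR \<longleftrightarrow> test_pair fL fR \<and>
     (\<forall>k<4. \<forall>x\<in>{-1..0}. (fL k has_real_derivative fL (Suc k) x) (at x within {-1..0})) \<and>
     (\<forall>k<4. \<forall>x\<in>{0..1}. (fR k has_real_derivative fR (Suc k) x) (at x within {0..1})) \<and>
     (\<forall>x\<in>{-1<..<0}. ode_residual rhom mum (B\<^sup>2) \<xi> la fL x = 0) \<and>
     (\<forall>x\<in>{0<..<1}. ode_residual rhop mup (B\<^sup>2) \<xi> la fR x = 0) \<and>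
     mup * la * (\<xi>\<^sup>2 * fR 0 0 + fR 2 0) - mum * la * (\<xi>\<^sup>2 * fL 0 0 + fL 2 0) = 0 \<and>
     mup * la * (fR 3 0 - 3 * \<xi>\<^sup>2 * fR 1 0) - mum * la * (fL 3 0 - 3 * \<xi>\<^sup>2 * fL 1 0)
       - (la\<^sup>2 * rhop * fR 1 0 - la\<^sup>2 * rhom * fL 1 0) = F"

text \<open>At \<open>-1\<close> and \<open>1\<close> the flux vanishes with the test pair. At
  \<open>0\<close> the two fluxes combine into the viscous jump conditions, and the magnetic
  contributions cancel because the first derivative of the mode is continuous.\<close>

lemma forced_mode_weak_form:
  assumes f: "forced_mode la F fL fR" and p: "test_pair pL pR"
  shows "energy la fL fR pL pR = F * pR 0 0"
proof -
  have "(energy_density rhom mum (B\<^sup>2) \<xi> la fL pL has_integral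
      (flux rhom mum (B\<^sup>2) \<xi> la fL pL 0 - flux rhom mum (B\<^sup>2) \<xi> la fL pL (-1))) {-1..0}"
    by (rule energy_density_has_integral_flux) (use f p in \<open>auto simp: forced_mode_def test_pair_def\<close>)
  moreover have "(energy_density rhop mup (B\<^sup>2) \<xi> la fR pR has_integral
      (flux rhop mup (B\<^sup>2) \<xi> la fR pR 1 - flux rhop mup (B\<^sup>2) \<xi> la fR pR 0)) {0..1}"
    by (rule energy_density_has_integral_flux) (use f p in \<open>auto simp: forced_mode_def test_pair_def\<close>)
  ultimately have "energy la fL fR pL pR = flux rhom mum (B\<^sup>2) \<xi> la fL pL 0 - flux rhom mum (B\<^sup>2) \<xi> la fL pL (-1)
     + (flux rhop mup (B\<^sup>2) \<xi> la fR pR 1 - flux rhop mup (B\<^sup>2) \<xi> la fR pR 0)"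
    unfolding energy_def by (simp add: integral_unique)
  also have "\<dots> = flux rhom mum (B\<^sup>2) \<xi> la fL pL 0 - flux rhop mup (B\<^sup>2) \<xi> la fR pR 0"
    using p by (simp add: flux_def test_pair_def)
  also have "\<dots> = (mup * la * (fR 3 0 - 3 * \<xi>\<^sup>2 * fR 1 0) - mum * la * (fL 3 0 - 3 * \<xi>\<^sup>2 * fL 1 0)
       - (la\<^sup>2 * rhop * fR 1 0 - la\<^sup>2 * rhom * fL 1 0)) * pR 0 0
     - (mup * la * (\<xi>\<^sup>2 * fR 0 0 + fR 2 0) - mum * la * (\<xi>\<^sup>2 * fL 0 0 + fL 2 0)) * pR 1 0
     + B\<^sup>2 * \<xi>\<^sup>2 * (fL 1 0 - fR 1 0) * pR 0 0"
    using p by (simp add: flux_def test_pair_def algebra_simps)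
  also have "\<dots> = F * pR 0 0"
  proof -
    have j: "mup * la * (\<xi>\<^sup>2 * fR 0 0 + fR 2 0) - mum * la * (\<xi>\<^sup>2 * fL 0 0 + fL 2 0) = 0"
      "fL 1 0 - fR 1 0 = 0" and F: "mup * la * (fR 3 0 - 3 * \<xi>\<^sup>2 * fR 1 0) - mum * la * (fL 3 0 - 3 * \<xi>\<^sup>2 * fL 1 0)
       - (la\<^sup>2 * rhop * fR 1 0 - la\<^sup>2 * rhom * fL 1 0) = F"
      using f by (auto simp: forced_mode_def test_pair_def)
    show ?thesis unfolding F j by simp
  qed
  finally show ?thesis .
qed

text \<open>The energy of \<open>t * f - p\<close> is a nonnegative quadratic in \<open>t\<close>,
  and the weak form evaluates its first two coefficients as values at \<open>0\<close>.\<close>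

lemma forced_mode_cauchy_schwarz:
  assumes "la > 0" and f: "forced_mode la 1 fL fR" and p: "test_pair pL pR"
  shows "(pR 0 0)\<^sup>2 \<le> fR 0 0 * energy la pL pR pL pR"
proof -
  have ft: "test_pair fL fR" using f by (simp add: forced_mode_def)
  have side: "0 \<le> t\<^sup>2 * integral {a..b} (energy_density r m \<beta> z la u u)
       - 2 * t * integral {a..b} (energy_density r m \<beta> z la u v) + integral {a..b} (energy_density r m \<beta> z la v v)"
    if "C2_family {a..b} u" "C2_family {a..b} v" "r > 0" "m > 0" "\<beta> \<ge> 0" for a b u v r m \<beta> z t
  proof -
    have "((\<lambda>x. t\<^sup>2 * energy_density r m \<beta> z la u u x - (2 * t) * energy_density r m \<beta> z la u v x
        + energy_density r m \<beta> z la v v x) has_integral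
        (t\<^sup>2 * integral {a..b} (energy_density r m \<beta> z la u u)
       - 2 * t * integral {a..b} (energy_density r m \<beta> z la u v) + integral {a..b} (energy_density r m \<beta> z la v v))) {a..b}"
      by (intro has_integral_add has_integral_diff has_integral_mult_right integrable_integral
            energy_density_integrable that)
    moreover have "0 \<le> t\<^sup>2 * energy_density r m \<beta> z la u u x - (2 * t) * energy_density r m \<beta> z la u v x
        + energy_density r m \<beta> z la v v x" for x
    proof -
      have "0 \<le> energy_density r m \<beta> z la (\<lambda>k x. t * u k x - v k x) (\<lambda>k x. t * u k x - v k x) x"
        using that assms by (intro energy_density_nonneg) auto
      thus ?thesis unfolding energy_density_def by (simp add: power2_eq_square algebra_simps)
    qed
    ultimately show ?thesis by (rule has_integral_nonneg)
  qed
  define h E where "h = fR 0 0" and "E = energy la pL pR pL pR"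
  have quad: "0 \<le> t\<^sup>2 * h - 2 * t * pR 0 0 + E" for t
  proof -
    have "0 \<le> t\<^sup>2 * energy la fL fR fL fR - 2 * t * energy la fL fR pL pR + E"
      using side[of "-1" 0 fL pL rhom mum "B\<^sup>2" t \<xi>] side[of 0 1 fR pR rhop mup "B\<^sup>2" t \<xi>]
        ft p rho_pos mu_pos unfolding energy_def E_def test_pair_def by (simp add: algebra_simps)
    thus ?thesis using forced_mode_weak_form[OF f ft] forced_mode_weak_form[OF f p] by (simp add: h_def)
  qed
  have "(pR 0 0)\<^sup>2 \<le> h * E"
  proof (cases "h = 0")
    case True
    have "pR 0 0 = 0"
    proof (rule ccontr)
      assume "pR 0 0 \<noteq> 0"
      \<comment> \<open>With \<open>h = 0\<close> the quadratic is affine in \<open>t\<close>, and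
        this \<open>t\<close> makes it equal to \<open>-1\<close>.\<close>
      thus False using quad[of "(E + 1) / (2 * pR 0 0)"] True by simp
    qed
    thus ?thesis using True by simp
  next
    case False
    have "h \<ge> 0"
    proof -
      show ?thesis using energy_nonneg[OF assms(1) ft] forced_mode_weak_form[OF f ft] by (simp add: h_def)
    qed
    hence "h > 0" using False by simp
    \<comment> \<open>The minimising \<open>t\<close>.\<close>
    thus ?thesis using quad[of "pR 0 0 / h"] by (simp add: field_simps power2_eq_square)
  qed
  thus ?thesis by (simp add: h_def E_def)
qed

text \<open>As a polynomial in \<open>la\<close> the energy has degree two and nonnegative
  coefficients, and the factor dominates \<open>1\<close>, \<open>la / la'\<close> and its square.
  One estimate thus covers both monotonicity statements about \<open>h\<close>.\<close>

lemma energy_rescale: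
  assumes "la > 0" "la' > 0" and p: "test_pair pL pR"
  shows "energy la pL pR pL pR \<le> max 1 ((la / la')\<^sup>2) * energy la' pL pR pL pR"
proof -
  define K where "K = max 1 ((la / la')\<^sup>2)"
  have K2: "la\<^sup>2 \<le> K * la'\<^sup>2"
  proof -
    have "(la / la')\<^sup>2 * la'\<^sup>2 \<le> K * la'\<^sup>2" unfolding K_def by (intro mult_right_mono) auto
    thus ?thesis using assms by (simp add: power_divide)
  qed
  have K1: "la \<le> K * la'"
  proof (cases "la \<le> la'")
    case True
    have "1 * la' \<le> K * la'" using assms unfolding K_def by (intro mult_right_mono) auto
    thus ?thesis using True by simp
  next
    case False
    hence "1 \<le> la / la'" using assms by simp
    hence "la / la' \<le> (la / la')\<^sup>2" using power_increasing[of 1 2 "la / la'"] by simp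
    also have "\<dots> \<le> K" by (simp add: K_def)
    finally show ?thesis using assms by (simp add: field_simps)
  qed
  have K0: "1 \<le> K" by (simp add: K_def)
  have side: "integral {a..b} (energy_density r m \<beta> z la u u) \<le> K * integral {a..b} (energy_density r m \<beta> z la' u u)"
    if "C2_family {a..b} u" "r > 0" "m > 0" "\<beta> \<ge> 0" for a b u r m \<beta> z
  proof -
    have "energy_density r m \<beta> z la u u x \<le> K * energy_density r m \<beta> z la' u u x" for x
    proof -
      define A where "A = z\<^sup>2 * u 0 x * u 0 x + u 1 x * u 1 x"
      define C where "C = (u 2 x + z\<^sup>2 * u 0 x) * (u 2 x + z\<^sup>2 * u 0 x) + 4 * z\<^sup>2 * u 1 x * u 1 x"
      have nn: "A \<ge> 0" "C \<ge> 0" unfolding A_def C_def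
        by (auto simp: mult.assoc simp flip: power2_eq_square)
      have "la\<^sup>2 * (r * A) \<le> (K * la'\<^sup>2) * (r * A)" using nn that K2 by (intro mult_right_mono) auto
      moreover have "la * (m * C) \<le> (K * la') * (m * C)" using nn that K1 by (intro mult_right_mono) auto
      moreover have "1 * (\<beta> * z\<^sup>2 * A) \<le> K * (\<beta> * z\<^sup>2 * A)" using nn that K0 by (intro mult_right_mono) auto
      ultimately show ?thesis unfolding energy_density_def A_def[symmetric] C_def[symmetric]
        by (simp add: algebra_simps)
    qed
    hence "integral {a..b} (energy_density r m \<beta> z la u u)
        \<le> integral {a..b} (\<lambda>x. K * energy_density r m \<beta> z la' u u x)"
      by (intro integral_le integrable_on_mult_right energy_density_integrable that) auto
    thus ?thesis by simp
  qed
  have "energy la pL pR pL pR \<le> K * energy la' pL pR pL pR"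
    unfolding energy_def distrib_left
    using p rho_pos mu_pos by (intro add_mono side) (auto simp: test_pair_def)
  thus ?thesis by (simp add: K_def)
qed

text \<open>The viscous terms and the undifferentiated kinetic term are discarded. The remaining
  Dirichlet integral bounds pointwise values, as the pair vanishes at the outer end of each unit
  interval. This yields injectivity of the forced problem, triviality of stable modes and the decay
  of \<open>h\<close>.\<close>

lemma energy_lower_bound:
  assumes "la > 0" and p: "test_pair pL pR"
  shows "x \<in> {-1..0} \<Longrightarrow> la\<^sup>2 * rhom * (pL 0 x)\<^sup>2 + static_energy pL pR \<le> energy la pL pR pL pR"
    and "x \<in> {0..1} \<Longrightarrow> la\<^sup>2 * rhop * (pR 0 x)\<^sup>2 + static_energy pL pR \<le> energy la pL pR pL pR"
proof -
  have CL: "C2_family {-1..0} pL" and CR: "C2_family {0..1} pR" using p by (auto simp: test_pair_def)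
  have side: "la\<^sup>2 * r * integral {a..b} (\<lambda>x. (u 1 x)\<^sup>2) + (B\<^sup>2 * \<xi>^4 * integral {a..b} (\<lambda>x. (u 0 x)\<^sup>2)
      + B\<^sup>2 * \<xi>\<^sup>2 * integral {a..b} (\<lambda>x. (u 1 x)\<^sup>2)) \<le> integral {a..b} (energy_density r m (B\<^sup>2) \<xi> la u u)"
    if u: "C2_family {a..b} u" and rm: "r > 0" "m > 0" for a b u r m
  proof -
    have i0: "(\<lambda>x. (u 0 x)\<^sup>2) integrable_on {a..b}" and i1: "(\<lambda>x. (u 1 x)\<^sup>2) integrable_on {a..b}"
      by (intro integrable_continuous_interval continuous_intros C2_family_continuous[OF u]; simp)+
    show ?thesis
    proof (rule has_integral_le)
      show "((\<lambda>x. la\<^sup>2 * r * (u 1 x)\<^sup>2 + (B\<^sup>2 * \<xi>^4 * (u 0 x)\<^sup>2 + B\<^sup>2 * \<xi>\<^sup>2 * (u 1 x)\<^sup>2)) has_integral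
        (la\<^sup>2 * r * integral {a..b} (\<lambda>x. (u 1 x)\<^sup>2) + (B\<^sup>2 * \<xi>^4 * integral {a..b} (\<lambda>x. (u 0 x)\<^sup>2)
        + B\<^sup>2 * \<xi>\<^sup>2 * integral {a..b} (\<lambda>x. (u 1 x)\<^sup>2)))) {a..b}"
        by (intro has_integral_add has_integral_mult_right integrable_integral i0 i1)
      show "(energy_density r m (B\<^sup>2) \<xi> la u u has_integral
          integral {a..b} (energy_density r m (B\<^sup>2) \<xi> la u u)) {a..b}"
        by (intro integrable_integral energy_density_integrable u)
      fix x
      have "0 \<le> la\<^sup>2 * r * (\<xi>\<^sup>2 * (u 0 x)\<^sup>2) + la * m * ((u 2 x + \<xi>\<^sup>2 * u 0 x)\<^sup>2 + 4 * \<xi>\<^sup>2 * (u 1 x)\<^sup>2)"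
        using rm assms(1) by (intro add_nonneg_nonneg mult_nonneg_nonneg) auto
      thus "la\<^sup>2 * r * (u 1 x)\<^sup>2 + (B\<^sup>2 * \<xi>^4 * (u 0 x)\<^sup>2 + B\<^sup>2 * \<xi>\<^sup>2 * (u 1 x)\<^sup>2)
          \<le> energy_density r m (B\<^sup>2) \<xi> la u u x"
        unfolding energy_density_def by (simp add: power2_eq_square power4_eq_xxxx algebra_simps)
    qed
  qed
  define IL IR where "IL = integral {-1..0} (\<lambda>x. (pL 1 x)\<^sup>2)" and "IR = integral {0..1} (\<lambda>x. (pR 1 x)\<^sup>2)"
  have sum: "la\<^sup>2 * rhom * IL + la\<^sup>2 * rhop * IR + static_energy pL pR \<le> energy la pL pR pL pR"
    using side[OF CL rho_pos(2) mu_pos(2)] side[OF CR rho_pos(1) mu_pos(1)]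
    unfolding energy_def static_energy_def IL_def IR_def by (simp add: power4_eq_xxxx power2_eq_square algebra_simps)
  have nn: "IL \<ge> 0" "IR \<ge> 0" unfolding IL_def IR_def
    by (intro integral_nonneg integrable_continuous_interval continuous_intros
        C2_family_continuous[OF CL] C2_family_continuous[OF CR]; simp)+
  have nn': "0 \<le> la\<^sup>2 * rhom * IL" "0 \<le> la\<^sup>2 * rhop * IR" using nn rho_pos by simp_all
  {
    assume x: "x \<in> {-1..0}"
    have "(pL 0 x - pL 0 (-1))\<^sup>2 \<le> IL" unfolding IL_def
      by (rule square_increment_le) (use x C2_family_derivatives(1)[OF CL] C2_family_continuous[OF CL, of 1] in auto)
    hence "la\<^sup>2 * rhom * (pL 0 x)\<^sup>2 \<le> la\<^sup>2 * rhom * IL"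
      using p rho_pos by (intro mult_left_mono) (auto simp: test_pair_def)
    thus "la\<^sup>2 * rhom * (pL 0 x)\<^sup>2 + static_energy pL pR \<le> energy la pL pR pL pR" using sum nn' by linarith
  }
  {
    assume x: "x \<in> {0..1}"
    have "(pR 0 1 - pR 0 x)\<^sup>2 \<le> IR" unfolding IR_def
      by (rule square_increment_le) (use x C2_family_derivatives(1)[OF CR] C2_family_continuous[OF CR, of 1] in auto)
    hence "la\<^sup>2 * rhop * (pR 0 x)\<^sup>2 \<le> la\<^sup>2 * rhop * IR"
      using p rho_pos by (intro mult_left_mono) (auto simp: test_pair_def)
    thus "la\<^sup>2 * rhop * (pR 0 x)\<^sup>2 + static_energy pL pR \<le> energy la pL pR pL pR" using sum nn' by linarith
  }
qed

end

section \<open>Modes with unit force\<close>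

text \<open>Exponentials for the characteristic roots \<open>s\<close>, \<open>-s\<close>,
  \<open>t\<close>, \<open>-t\<close> of the fourth-order equation. The coefficients form a nested
  pair, so that they live in a Euclidean space.\<close>

definition exp_family :: "real \<Rightarrow> real \<Rightarrow> real \<times> real \<times> real \<times> real \<Rightarrow> nat \<Rightarrow> real \<Rightarrow> real" where
  "exp_family s t c k x = fst c * s^k * exp (s * x) + fst (snd c) * (-s)^k * exp (- s * x)
     + fst (snd (snd c)) * t^k * exp (t * x) + snd (snd (snd c)) * (-t)^k * exp (- t * x)"

lemma exp_family_deriv:
  "(exp_family s t c k has_real_derivative exp_family s t c (Suc k) x) (at x within S)"
  unfolding exp_family_def[abs_def]
  by (auto intro!: derivative_eq_intros simp: algebra_simps)

text \<open>The operator factors as \<open>(D\<^sup>2 - s\<^sup>2) (m * la * (D\<^sup>2 - s\<^sup>2)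
  - (la\<^sup>2 * r + \<beta> * s\<^sup>2))\<close>, and the assumption makes \<open>t\<close> and
  \<open>-t\<close> roots of the second factor.\<close>

lemma exp_family_ode:
  assumes "m * la * (t\<^sup>2 - s\<^sup>2) = la\<^sup>2 * r + \<beta> * s\<^sup>2"
  shows "ode_residual r m \<beta> s la (exp_family s t c) x = 0"
proof -
  define E where "E = fst (snd (snd c)) * exp (t * x) + snd (snd (snd c)) * exp (- t * x)"
  define A where "A = fst c * exp (s * x) + fst (snd c) * exp (- s * x)"
  have f: "exp_family s t c 0 x = A + E" "exp_family s t c 2 x = s\<^sup>2 * A + t\<^sup>2 * E"
    "exp_family s t c 4 x = s\<^sup>2 * s\<^sup>2 * A + t\<^sup>2 * t\<^sup>2 * E"
    by (simp_all add: exp_family_def A_def E_def algebra_simps power2_eq_square power4_eq_xxxx)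
  have "ode_residual r m \<beta> s la (exp_family s t c) x
      = (m * la * (t\<^sup>2 - s\<^sup>2) - (la\<^sup>2 * r + \<beta> * s\<^sup>2)) * (t\<^sup>2 - s\<^sup>2) * E"
    unfolding ode_residual_def f by (simp add: algebra_simps power2_eq_square power4_eq_xxxx)
  thus ?thesis using assms by simp
qed

text \<open>Linear independence: the function and its first three derivatives at the midpoint give a
  Vandermonde system. It splits by parity into two systems of size two, both solvable since
  \<open>t\<^sup>2 \<noteq> s\<^sup>2\<close>.\<close>

lemma exp_family_eq_0_imp:
  assumes s: "0 < s" "s < t" and ab: "a < b" and z: "\<And>x. x \<in> {a<..<b} \<Longrightarrow> exp_family s t c 0 x = 0"
  shows "c = 0"
proof -
  have all0: "\<forall>x\<in>{a<..<b}. exp_family s t c k x = 0" for k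
  proof (induction k)
    case (Suc k)
    show ?case
    proof
      fix x assume x: "x \<in> {a<..<b}"
      have "((\<lambda>_. 0) has_real_derivative exp_family s t c (Suc k) x) (at x)"
        by (rule has_field_derivative_transform_within_open
            [OF exp_family_deriv[of s t c k x UNIV], where S="{a<..<b}"]) (use Suc x in auto)
      thus "exp_family s t c (Suc k) x = 0" using DERIV_unique DERIV_const by blast
    qed
  qed (use z in auto)
  define x where "x = (a + b) / 2"
  have x: "x \<in> {a<..<b}" using ab by (simp add: x_def)
  obtain c1 c2 c3 c4 where c: "c = (c1, c2, c3, c4)" by (metis surj_pair)
  define e1 e2 e3 e4 where "e1 = c1 * exp (s * x)" and "e2 = c2 * exp (- s * x)"
    and "e3 = c3 * exp (t * x)" and "e4 = c4 * exp (- t * x)"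
  have q0: "e1 + e2 + e3 + e4 = 0"
    using all0[of 0] x by (auto simp: exp_family_def c e1_def e2_def e3_def e4_def)
  have q1: "s * (e1 - e2) + t * (e3 - e4) = 0"
    using all0[of 1] x by (auto simp: exp_family_def c e1_def e2_def e3_def e4_def algebra_simps)
  have q2: "s\<^sup>2 * (e1 + e2) + t\<^sup>2 * (e3 + e4) = 0"
    using all0[of 2] x by (auto simp: exp_family_def c e1_def e2_def e3_def e4_def algebra_simps)
  have q3: "s\<^sup>2 * (s * (e1 - e2)) + t\<^sup>2 * (t * (e3 - e4)) = 0"
    using all0[of 3] x by (auto simp: exp_family_def c e1_def e2_def e3_def e4_def algebra_simps power2_eq_square power3_eq_cube)
  have ne: "t\<^sup>2 - s\<^sup>2 \<noteq> 0" using s by (simp add: power2_eq_iff)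
  have "(t\<^sup>2 - s\<^sup>2) * (e3 + e4) = 0" using q0 q2 by algebra
  hence p1: "e3 + e4 = 0" using ne by simp
  have "(t\<^sup>2 - s\<^sup>2) * (t * (e3 - e4)) = 0" using q1 q3 by algebra
  hence p2: "e3 - e4 = 0" using ne s by simp
  have p3: "e1 + e2 = 0" using p1 q0 by simp
  have p4: "e1 - e2 = 0" using p2 q1 s by simp
  have "e1 = 0" "e2 = 0" "e3 = 0" "e4 = 0" using p1 p2 p3 p4 by linarith+
  thus ?thesis by (simp add: c e1_def e2_def e3_def e4_def zero_prod_def)
qed

lemma exp_family_add: "exp_family s t (c + d) k x = exp_family s t c k x + exp_family s t d k x"
  by (simp add: exp_family_def algebra_simps)

lemma exp_family_scaleR: "exp_family s t (a *\<^sub>R c) k x = a * exp_family s t c k x"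
  by (simp add: exp_family_def algebra_simps)

section \<open>Solvability of the forced problem by linear algebra\<close>

context slab
begin

lemma unit_forced_mode_exists:
  assumes la: "la > 0" and xi: "\<xi> > 0"
  shows "\<exists>fL fR. forced_mode la 1 fL fR \<and>
     (\<forall>k x. (fL k has_real_derivative fL (Suc k) x) (at x)) \<and>
     (\<forall>k x. (fR k has_real_derivative fR (Suc k) x) (at x))"
proof -
  \<comment> \<open>\<open>tm\<close> and \<open>tp\<close> are the second characteristic roots in
    the lower and the upper layer; the first one is \<open>\<xi>\<close> in both.\<close>
  define tm where "tm = sqrt (\<xi>\<^sup>2 + (la\<^sup>2 * rhom + B\<^sup>2 * \<xi>\<^sup>2) / (mum * la))"
  define tp where "tp = sqrt (\<xi>\<^sup>2 + (la\<^sup>2 * rhop + B\<^sup>2 * \<xi>\<^sup>2) / (mup * la))"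
  have quot: "(la\<^sup>2 * r + B\<^sup>2 * \<xi>\<^sup>2) / (m * la) > 0" if "r > 0" "m > 0" for r m
    using that la by (intro divide_pos_pos add_pos_nonneg) auto
  have tm: "mum * la * (tm\<^sup>2 - \<xi>\<^sup>2) = la\<^sup>2 * rhom + B\<^sup>2 * \<xi>\<^sup>2" "\<xi> < tm"
    using quot[OF rho_pos(2) mu_pos(2)] la mu_pos xi
    by (auto simp: tm_def add_nonneg_nonneg less_imp_le intro!: real_less_rsqrt)
  have tp: "mup * la * (tp\<^sup>2 - \<xi>\<^sup>2) = la\<^sup>2 * rhop + B\<^sup>2 * \<xi>\<^sup>2" "\<xi> < tp"
    using quot[OF rho_pos(1) mu_pos(1)] la mu_pos xi
    by (auto simp: tp_def add_nonneg_nonneg less_imp_le intro!: real_less_rsqrt)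
  define eL eR where "eL = exp_family \<xi> tm" and "eR = exp_family \<xi> tp"
  note lin = eL_def eR_def exp_family_add exp_family_scaleR
  \<comment> \<open>Domain and codomain have the same type, so injectivity will give surjectivity.
    The last component is the force; the other seven conditions are homogeneous.\<close>
  define T where "T = (\<lambda>(c, d).
      ((eL c 0 (-1), eL c 1 (-1), eR d 0 1, eR d 1 1),
       (eR d 0 0 - eL c 0 0, eR d 1 0 - eL c 1 0,
        mup * la * (\<xi>\<^sup>2 * eR d 0 0 + eR d 2 0) - mum * la * (\<xi>\<^sup>2 * eL c 0 0 + eL c 2 0),
        mup * la * (eR d 3 0 - 3 * \<xi>\<^sup>2 * eR d 1 0) - mum * la * (eL c 3 0 - 3 * \<xi>\<^sup>2 * eL c 1 0)
         - (la\<^sup>2 * rhop * eR d 1 0 - la\<^sup>2 * rhom * eL c 1 0))))"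
  have linT: "linear T"
    by (rule linearI) (simp_all add: T_def lin case_prod_beta algebra_simps)
  have mode: "forced_mode la F (eL c) (eR d)" if "T (c, d) = ((0,0,0,0), (0,0,0,F))" for c d F
    unfolding forced_mode_def test_pair_def C2_family_def
    using that exp_family_ode[OF tm(1)] exp_family_ode[OF tp(1)]
    by (auto simp: T_def eL_def eR_def exp_family_deriv
        intro!: DERIV_continuous_on[OF exp_family_deriv])
  have "inj T"
  proof (rule linear_injective_0[OF linT, THEN iffD2], intro allI impI)
    fix cd assume "T cd = 0"
    moreover obtain c d where cd: "cd = (c, d)" by (cases cd)
    \<comment> \<open>A kernel element is a mode without force; tested with itself it has zero
      energy.\<close>
    ultimately have m: "forced_mode la 0 (eL c) (eR d)"
      by (intro mode) (simp add: zero_prod_def)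
    hence t: "test_pair (eL c) (eR d)" by (simp add: forced_mode_def)
    have e0: "energy la (eL c) (eR d) (eL c) (eR d) = 0"
      using forced_mode_weak_form[OF m t] by simp
    have "eL c 0 x = 0" if "x \<in> {-1<..<0}" for x
    proof -
      have "la\<^sup>2 * rhom * (eL c 0 x)\<^sup>2 \<le> 0"
        using energy_lower_bound(1)[OF la t, of x] static_energy_nonneg[of "eL c" "eR d"] e0 that by simp
      thus ?thesis using la rho_pos by (simp add: mult_le_0_iff)
    qed
    hence "c = 0" unfolding eL_def by (rule exp_family_eq_0_imp[OF xi tm(2), of "-1" 0, rotated]) auto
    have "eR d 0 x = 0" if "x \<in> {0<..<1}" for x
    proof -
      have "la\<^sup>2 * rhop * (eR d 0 x)\<^sup>2 \<le> 0"
        using energy_lower_bound(2)[OF la t, of x] static_energy_nonneg[of "eL c" "eR d"] e0 that by simp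
      thus ?thesis using la rho_pos by (simp add: mult_le_0_iff)
    qed
    hence "d = 0" unfolding eR_def by (rule exp_family_eq_0_imp[OF xi tp(2), of 0 1, rotated]) auto
    show "cd = 0" using \<open>c = 0\<close> \<open>d = 0\<close> by (simp add: cd zero_prod_def)
  qed
  hence "surj T" by (rule linear_inj_imp_surj[OF linT])
  then obtain c d where "T (c, d) = ((0,0,0,0), (0,0,0,1))" by (metis surjD surj_pair)
  hence "forced_mode la 1 (eL c) (eR d)" by (rule mode)
  thus ?thesis using exp_family_deriv unfolding eL_def eR_def by blast
qed

end

section \<open>Instability below the critical frequency\<close>

lemma antiderivative_exists:
  fixes q :: "real \<Rightarrow> real"
  assumes "continuous_on UNIV q"
  obtains p where "p a = 0" "\<And>y. y \<in> {a..b} \<Longrightarrow> (p has_real_derivative q y) (at y)"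
proof (rule that[of "\<lambda>y. integral {a-1..y} q - integral {a-1..a} q"])
  show "integral {a-1..a} q - integral {a-1..a} q = 0" by simp
  fix y assume y: "y \<in> {a..b}"
  \<comment> \<open>Enlarging the interval by one on both sides puts \<open>{a..b}\<close> into its
    interior, which makes the derivative two-sided.\<close>
  have "((\<lambda>y. integral {a-1..y} q) has_real_derivative q y) (at y within {a-1..b+1})"
    using y by (intro integral_has_real_derivative continuous_on_subset[OF assms]) auto
  hence "((\<lambda>y. integral {a-1..y} q) has_real_derivative q y) (at y)"
    using y by (simp add: at_within_Icc_at)
  thus "((\<lambda>y. integral {a-1..y} q - integral {a-1..a} q) has_real_derivative q y) (at y)"
    by (auto intro!: derivative_eq_intros)
qed

text \<open>Cutting off the derivative of the minimiser \<open>sinh (s (1 - |x|))\<close> near \<open>0\<close> and \<open>\<plusminus>1\<close> makes it admissible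
  and only decreases its energy, at the price of an arbitrarily small loss of the value at \<open>0\<close>.\<close>
lemma near_optimal_test_pair:
  assumes s: "s > 0" and Q: "Q < (sinh s)\<^sup>2"
  obtains pL pR where "test_pair pL pR" "pR 0 0 \<noteq> 0" "Q < (pR 0 0)\<^sup>2"
    "s\<^sup>2 * (integral {-1..0} (\<lambda>x. (pL 0 x)\<^sup>2) + integral {0..1} (\<lambda>x. (pR 0 x)\<^sup>2))
        + (integral {-1..0} (\<lambda>x. (pL 1 x)\<^sup>2) + integral {0..1} (\<lambda>x. (pR 1 x)\<^sup>2)) \<le> 2 * s * sinh s * cosh s"
proof -
  \<comment> \<open>The subtracted term is the loss at \<open>0\<close> caused by the cut-off, as
    estimated in \<open>p1\<close>; \<open>n\<close> is fixed here so that the loss is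
    harmless.\<close>
  have lim: "(\<lambda>n. sinh s - 2 * s * cosh s * inverse (real (Suc n))) \<longlonglongrightarrow> sinh s - 2 * s * cosh s * 0"
    by (intro tendsto_intros LIMSEQ_inverse_real_of_nat)
  hence lim: "(\<lambda>n. sinh s - 2 * s * cosh s * inverse (real (Suc n))) \<longlonglongrightarrow> sinh s" by simp
  have "\<forall>\<^sub>F n in sequentially. 0 < sinh s - 2 * s * cosh s * inverse (real (Suc n))"
    using s by (intro order_tendstoD(1)[OF lim]) simp
  moreover have "\<forall>\<^sub>F n in sequentially. Q < (sinh s - 2 * s * cosh s * inverse (real (Suc n)))\<^sup>2"
    by (intro order_tendstoD(1)[OF tendsto_power[OF lim]] Q)
  ultimately have "\<forall>\<^sub>F n in sequentially. 0 < sinh s - 2 * s * cosh s * inverse (real (Suc n)) \<and>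
     Q < (sinh s - 2 * s * cosh s * inverse (real (Suc n)))\<^sup>2 \<and> n \<ge> 1"
    by (intro eventually_conj eventually_ge_at_top)
  then obtain n where n: "0 < sinh s - 2 * s * cosh s * inverse (real (Suc n))"
     "Q < (sinh s - 2 * s * cosh s * inverse (real (Suc n)))\<^sup>2" "n \<ge> 1"
    by (metis (mono_tags, lifting) eventually_happens' sequentially_bot)
  \<comment> \<open>In the distance \<open>y\<close> from the outer boundary, this is the derivative
    of the minimiser times a cut-off that vanishes at \<open>y = 0\<close> and \<open>y = 1\<close>,
    because \<open>n \<ge> 1\<close>. It gives the clamped condition and equal slopes at the
    interface.\<close>
  define q where "q y = s * cosh (s * y) * (1 - y^n - (1-y)^n)" for y
  define q1 where "q1 y = s\<^sup>2 * sinh (s * y) * (1 - y^n - (1-y)^n)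
     + s * cosh (s * y) * (real n * (1-y)^(n-1) - real n * y^(n-1))" for y
  have dq: "(q has_real_derivative q1 y) (at y)" for y
    unfolding q_def[abs_def] q1_def
    by (auto intro!: derivative_eq_intros simp: power2_eq_square algebra_simps)
  have cq: "continuous_on A q" for A unfolding q_def[abs_def] by (intro continuous_intros)
  have cq1: "continuous_on A q1" for A unfolding q1_def[abs_def] by (intro continuous_intros)
  obtain p where p0: "p 0 = 0" and dp: "\<And>y. y \<in> {0..1} \<Longrightarrow> (p has_real_derivative q y) (at y)"
    using antiderivative_exists[OF cq, of 0 1] by blast
  have q01: "q 0 = 0" "q 1 = 0" using n(3) by (auto simp: q_def)
  have cut: "0 \<le> 1 - y^n - (1-y)^n" "1 - y^n - (1-y)^n \<le> 1" if "y \<in> {0..1}" for y :: real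
  proof -
    have "y^n \<le> y^1" "(1-y)^n \<le> (1-y)^1" using that n(3) by (intro power_decreasing; simp)+
    thus "0 \<le> 1 - y^n - (1-y)^n" by simp
    show "1 - y^n - (1-y)^n \<le> 1" using that zero_le_power[of y n] zero_le_power[of "1 - y" n] unfolding atLeastAtMost_iff by linarith
  qed
  have qb: "0 \<le> q y" "q y \<le> s * cosh (s * y)" if "y \<in> {0..1}" for y
    using cut[OF that] s mult_left_le[of "1 - y^n - (1-y)^n" "s * cosh (s * y)"]
    by (auto simp: q_def cosh_real_nonneg)
  have mono: "h 0 \<le> h y" if "y \<in> {0..1}" "\<And>z. z \<in> {0..1} \<Longrightarrow> (h has_real_derivative h' z) (at z)"
     "\<And>z. z \<in> {0..1} \<Longrightarrow> 0 \<le> h' z" for h h' :: "real \<Rightarrow> real" and y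
    using that by (intro DERIV_nonneg_imp_nondecreasing[of 0 y h]) force+
  have pb: "0 \<le> p y" "p y \<le> sinh (s * y)" if y: "y \<in> {0..1}" for y
  proof -
    show "0 \<le> p y" using mono[OF y dp qb(1)] p0 by simp
    have "sinh (s * 0) - p 0 \<le> sinh (s * y) - p y"
    proof (rule mono[OF y, where h' = "\<lambda>z. s * cosh (s * z) - q z"])
      fix z :: real assume z: "z \<in> {0..1}"
      show "((\<lambda>y. sinh (s * y) - p y) has_real_derivative s * cosh (s * z) - q z) (at z)"
        using dp[OF z] by (auto intro!: derivative_eq_intros simp: mult.commute)
      show "0 \<le> s * cosh (s * z) - q z" using qb(2)[OF z] by simp
    qed
    thus "p y \<le> sinh (s * y)" using p0 by simp
  qed
  have p1: "sinh s - 2 * s * cosh s * inverse (real (Suc n)) \<le> p 1"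
  proof -
    \<comment> \<open>To \<open>p - sinh\<close> a primitive of a bound for the removed part is
      added, so \<open>h\<close> is nondecreasing. Comparing \<open>h 0\<close> with
      \<open>h 1\<close> collects \<open>s * cosh s / (n + 1)\<close> twice.\<close>
    define h where "h y = p y - sinh (s * y) + s * cosh s * (y^Suc n - (1-y)^Suc n) / real (Suc n)" for y
    have "h 0 \<le> h 1"
    proof (rule mono[where h' = "\<lambda>y. q y - s * cosh (s * y) + s * cosh s * (y^n + (1-y)^n)"])
      fix y :: real assume y: "y \<in> {0..1}"
      have "((\<lambda>y. s * cosh s * (y^Suc n - (1-y)^Suc n) / real (Suc n)) has_real_derivative
          s * cosh s * (real (Suc n) * y^n + real (Suc n) * (1-y)^n) / real (Suc n)) (at y)"
        by (rule derivative_eq_intros refl | simp)+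
      moreover have "s * cosh s * (real (Suc n) * y^n + real (Suc n) * (1-y)^n) / real (Suc n) = s * cosh s * (y^n + (1-y)^n)"
        by (simp add: field_simps)
      ultimately have tail: "((\<lambda>y. s * cosh s * (y^Suc n - (1-y)^Suc n) / real (Suc n)) has_real_derivative
          s * cosh s * (y^n + (1-y)^n)) (at y)" by simp
      have "((\<lambda>y. sinh (s * y)) has_real_derivative s * cosh (s * y)) (at y)"
        by (auto intro!: derivative_eq_intros simp: mult.commute)
      from DERIV_add[OF DERIV_diff[OF dp[OF y] this] tail]
      show "(h has_real_derivative q y - s * cosh (s * y) + s * cosh s * (y^n + (1-y)^n)) (at y)"
        unfolding h_def[abs_def] .
      have "cosh (s * y) \<le> cosh s" using y s by (intro cosh_real_nonneg_le_iff[THEN iffD2]) (auto simp: mult_left_le)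
      hence "s * cosh (s * y) * (y^n + (1-y)^n) \<le> s * cosh s * (y^n + (1-y)^n)"
        using s y by (intro mult_right_mono mult_left_mono) auto
      thus "0 \<le> q y - s * cosh (s * y) + s * cosh s * (y^n + (1-y)^n)"
        by (simp add: q_def algebra_simps)
    qed auto
    thus ?thesis using p0 by (simp add: h_def field_simps del: of_nat_Suc)
  qed
  \<comment> \<open>The distance is \<open>y = 1 - x\<close> on the right and
    \<open>y = 1 + x\<close> on the left; the reflection flips the sign of the first derivative on
    the right.\<close>
  define pR where "pR k x = (if k = 0 then p (1-x) else if k = 1 then - q (1-x) else q1 (1-x))" for k :: nat and x
  define pL where "pL k x = (if k = 0 then p (1+x) else if k = 1 then q (1+x) else q1 (1+x))" for k :: nat and x
  have dm: "((\<lambda>x. 1 - x) has_real_derivative -1) (at x)" and da: "((\<lambda>x. 1 + x) has_real_derivative 1) (at x)"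
    for x :: real by (auto intro!: derivative_eq_intros)
  have CR: "C2_family {0..1} pR"
    unfolding C2_family_def
  proof (intro conjI allI impI ballI)
    fix k :: nat and x :: real assume k: "k < 2" and x: "x \<in> {0..1}"
    have "((\<lambda>x. p (1-x)) has_real_derivative - q (1-x)) (at x)"
      using DERIV_chain2[where f = p and g = "\<lambda>x. 1-x" and x = x and s = UNIV, OF _ dm, OF dp] x by simp
    moreover have "((\<lambda>x. - q (1-x)) has_real_derivative q1 (1-x)) (at x)"
      using DERIV_minus[OF DERIV_chain2[where f = q and g = "\<lambda>x. 1-x" and x = x and s = UNIV, OF dq dm]] by simp
    ultimately have "(pR k has_real_derivative pR (Suc k) x) (at x)"
      using k by (auto simp: pR_def[abs_def] less_2_cases_iff)
    thus "(pR k has_real_derivative pR (Suc k) x) (at x within {0..1})"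
      by (rule has_field_derivative_at_within)
  next
    show "continuous_on {0..1} (pR 2)" unfolding pR_def[abs_def]
      by (auto intro!: continuous_on_compose2[OF cq1[of UNIV]] continuous_intros)
  qed
  have CL: "C2_family {-1..0} pL"
    unfolding C2_family_def
  proof (intro conjI allI impI ballI)
    fix k :: nat and x :: real assume k: "k < 2" and x: "x \<in> {-1..0}"
    have "((\<lambda>x. p (1+x)) has_real_derivative q (1+x)) (at x)"
      using DERIV_chain2[where f = p and g = "\<lambda>x. 1+x" and x = x and s = UNIV, OF _ da, OF dp] x by simp
    moreover have "((\<lambda>x. q (1+x)) has_real_derivative q1 (1+x)) (at x)"
      using DERIV_chain2[where f = q and g = "\<lambda>x. 1+x" and x = x and s = UNIV, OF dq da] by simp
    ultimately have "(pL k has_real_derivative pL (Suc k) x) (at x)"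
      using k by (auto simp: pL_def[abs_def] less_2_cases_iff)
    thus "(pL k has_real_derivative pL (Suc k) x) (at x within {-1..0})"
      by (rule has_field_derivative_at_within)
  next
    show "continuous_on {-1..0} (pL 2)" unfolding pL_def[abs_def]
      by (auto intro!: continuous_on_compose2[OF cq1[of UNIV]] continuous_intros)
  qed
  have tp: "test_pair pL pR"
    unfolding test_pair_def using CL CR by (simp add: p0 q01 pL_def pR_def)
  \<comment> \<open>Pointwise comparison of \<open>p\<close> and \<open>q\<close> with the minimiser
    and its derivative. \<open>F\<close> is an antiderivative of the minimiser's energy density, and
    each half contributes at most \<open>s * sinh s * cosh s\<close>.\<close>
  have half: "s\<^sup>2 * integral {a..b} (\<lambda>x. (u 0 x)\<^sup>2) + integral {a..b} (\<lambda>x. (u 1 x)\<^sup>2) \<le> F b - F a"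
    if u: "C2_family {a..b} u" and y: "\<And>x. x \<in> {a..b} \<Longrightarrow> y x \<in> {0..1} \<and> \<bar>u 0 x\<bar> = p (y x) \<and> \<bar>u 1 x\<bar> = q (y x)"
      and F: "\<And>x. x \<in> {a..b} \<Longrightarrow> (F has_real_derivative s\<^sup>2 * ((sinh (s * y x))\<^sup>2 + (cosh (s * y x))\<^sup>2)) (at x within {a..b})"
      and "a \<le> b"
    for a b u F and y :: "real \<Rightarrow> real"
  proof (rule has_integral_le)
    show "((\<lambda>x. s\<^sup>2 * (u 0 x)\<^sup>2 + (u 1 x)\<^sup>2) has_integral
      (s\<^sup>2 * integral {a..b} (\<lambda>x. (u 0 x)\<^sup>2) + integral {a..b} (\<lambda>x. (u 1 x)\<^sup>2))) {a..b}"
      by (intro has_integral_add has_integral_mult_right integrable_integral integrable_continuous_interval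
          continuous_intros C2_family_continuous[OF u]) auto
    show "((\<lambda>x. s\<^sup>2 * ((sinh (s * y x))\<^sup>2 + (cosh (s * y x))\<^sup>2)) has_integral (F b - F a)) {a..b}"
      using F \<open>a \<le> b\<close> by (intro fundamental_theorem_of_calculus)
        (auto simp: has_real_derivative_iff_has_vector_derivative[symmetric])
    fix x assume "x \<in> {a..b}"
    from y[OF this] have "y x \<in> {0..1}" "(u 0 x)\<^sup>2 = (p (y x))\<^sup>2" "(u 1 x)\<^sup>2 = (q (y x))\<^sup>2"
      by (metis power2_abs)+
    moreover from this have "(p (y x))\<^sup>2 \<le> (sinh (s * y x))\<^sup>2" "(q (y x))\<^sup>2 \<le> (s * cosh (s * y x))\<^sup>2"
      using pb qb by (intro power_mono; simp)+
    ultimately show "s\<^sup>2 * (u 0 x)\<^sup>2 + (u 1 x)\<^sup>2 \<le> s\<^sup>2 * ((sinh (s * y x))\<^sup>2 + (cosh (s * y x))\<^sup>2)"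
      using mult_left_mono[of "(p (y x))\<^sup>2" "(sinh (s * y x))\<^sup>2" "s\<^sup>2"]
      by (simp add: power_mult_distrib distrib_left)
  qed
  have "s\<^sup>2 * integral {0..1} (\<lambda>x. (pR 0 x)\<^sup>2) + integral {0..1} (\<lambda>x. (pR 1 x)\<^sup>2)
     \<le> (\<lambda>x. - (s * sinh (s * (1-x)) * cosh (s * (1-x)))) 1 - (\<lambda>x. - (s * sinh (s * (1-x)) * cosh (s * (1-x)))) 0"
    by (rule half[OF CR, where y = "\<lambda>x. 1 - x"])
       (use pb qb in \<open>auto simp: pR_def power2_eq_square algebra_simps intro!: derivative_eq_intros\<close>)
  moreover have "s\<^sup>2 * integral {-1..0} (\<lambda>x. (pL 0 x)\<^sup>2) + integral {-1..0} (\<lambda>x. (pL 1 x)\<^sup>2)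
     \<le> (\<lambda>x. s * sinh (s * (1+x)) * cosh (s * (1+x))) 0 - (\<lambda>x. s * sinh (s * (1+x)) * cosh (s * (1+x))) (-1)"
    by (rule half[OF CL, where y = "\<lambda>x. 1 + x"])
       (use pb qb in \<open>auto simp: pL_def power2_eq_square algebra_simps intro!: derivative_eq_intros\<close>)
  ultimately have "s\<^sup>2 * (integral {-1..0} (\<lambda>x. (pL 0 x)\<^sup>2) + integral {0..1} (\<lambda>x. (pR 0 x)\<^sup>2))
        + (integral {-1..0} (\<lambda>x. (pL 1 x)\<^sup>2) + integral {0..1} (\<lambda>x. (pR 1 x)\<^sup>2)) \<le> 2 * s * sinh s * cosh s"
    by (simp add: distrib_left)
  moreover have "pR 0 0 = p 1" by (simp add: pR_def)
  moreover have "Q < (p 1)\<^sup>2"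
    using n(2) power_mono[OF p1, of 2] n(1) by linarith
  moreover have "p 1 \<noteq> 0" using n(1) p1 by linarith
  ultimately show ?thesis using that tp by simp
qed

section \<open>Tuning the growth rate until gravity supplies the unit force\<close>

context slab
begin

text \<open>Serves for the limit \<open>la \<rightarrow> 0\<close>, in which only
  \<open>static_energy\<close> remains.\<close>

lemma energy_polynomial:
  assumes p: "test_pair pL pR"
  obtains A C where "\<And>la. energy la pL pR pL pR = la\<^sup>2 * A + la * C + static_energy pL pR"
proof -
  have side: "\<exists>A C. \<forall>la. integral {a..b} (energy_density r m (B\<^sup>2) \<xi> la u u) = la\<^sup>2 * A + la * C
       + (B\<^sup>2 * \<xi>^4 * integral {a..b} (\<lambda>x. (u 0 x)\<^sup>2) + B\<^sup>2 * \<xi>\<^sup>2 * integral {a..b} (\<lambda>x. (u 1 x)\<^sup>2))"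
    if u: "C2_family {a..b} u" for a b u r m
  proof (intro exI allI)
    fix la
    let ?A = "\<lambda>x. r * (\<xi>\<^sup>2 * u 0 x * u 0 x + u 1 x * u 1 x)"
    let ?C = "\<lambda>x. m * ((u 2 x + \<xi>\<^sup>2 * u 0 x) * (u 2 x + \<xi>\<^sup>2 * u 0 x) + 4 * \<xi>\<^sup>2 * u 1 x * u 1 x)"
    have "((\<lambda>x. la\<^sup>2 * ?A x + la * ?C x + (B\<^sup>2 * \<xi>^4 * (u 0 x)\<^sup>2 + B\<^sup>2 * \<xi>\<^sup>2 * (u 1 x)\<^sup>2)) has_integral
       (la\<^sup>2 * integral {a..b} ?A + la * integral {a..b} ?C
       + (B\<^sup>2 * \<xi>^4 * integral {a..b} (\<lambda>x. (u 0 x)\<^sup>2) + B\<^sup>2 * \<xi>\<^sup>2 * integral {a..b} (\<lambda>x. (u 1 x)\<^sup>2)))) {a..b}"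
      by (intro has_integral_add has_integral_mult_right integrable_integral integrable_continuous_interval
          continuous_intros C2_family_continuous[OF u]) auto
    moreover have "(\<lambda>x. la\<^sup>2 * ?A x + la * ?C x + (B\<^sup>2 * \<xi>^4 * (u 0 x)\<^sup>2 + B\<^sup>2 * \<xi>\<^sup>2 * (u 1 x)\<^sup>2))
        = energy_density r m (B\<^sup>2) \<xi> la u u"
      by (rule ext) (simp add: energy_density_def power2_eq_square power4_eq_xxxx algebra_simps)
    ultimately show "integral {a..b} (energy_density r m (B\<^sup>2) \<xi> la u u) =
       la\<^sup>2 * integral {a..b} ?A + la * integral {a..b} ?C
       + (B\<^sup>2 * \<xi>^4 * integral {a..b} (\<lambda>x. (u 0 x)\<^sup>2) + B\<^sup>2 * \<xi>\<^sup>2 * integral {a..b} (\<lambda>x. (u 1 x)\<^sup>2))"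
      by (simp only: integral_unique)
  qed
  from side[of "-1" 0 pL rhom mum] obtain A1 C1 where 1: "\<And>la. integral {-1..0} (energy_density rhom mum (B\<^sup>2) \<xi> la pL pL)
      = la\<^sup>2 * A1 + la * C1 + (B\<^sup>2 * \<xi>^4 * integral {-1..0} (\<lambda>x. (pL 0 x)\<^sup>2) + B\<^sup>2 * \<xi>\<^sup>2 * integral {-1..0} (\<lambda>x. (pL 1 x)\<^sup>2))"
    using p by (auto simp: test_pair_def)
  from side[of 0 1 pR rhop mup] obtain A2 C2 where 2: "\<And>la. integral {0..1} (energy_density rhop mup (B\<^sup>2) \<xi> la pR pR)
      = la\<^sup>2 * A2 + la * C2 + (B\<^sup>2 * \<xi>^4 * integral {0..1} (\<lambda>x. (pR 0 x)\<^sup>2) + B\<^sup>2 * \<xi>\<^sup>2 * integral {0..1} (\<lambda>x. (pR 1 x)\<^sup>2))"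
    using p by (auto simp: test_pair_def)
  show ?thesis
    by (rule that[of "A1 + A2" "C1 + C2"])
       (unfold energy_def 1 2 static_energy_def, simp add: algebra_simps power2_eq_square power4_eq_xxxx)
qed

text \<open>Here \<open>c\<close> stands for \<open>g * (rhop - rhom) * \<xi>\<^sup>2\<close>. The
  growth rate comes from the intermediate value theorem for \<open>h\<close> at the level
  \<open>1 / c\<close>.\<close>

lemma resonant_mode_exists:
  assumes xi: "\<xi> > 0" and c: "c > 0" and p: "test_pair pL pR" "pR 0 0 \<noteq> 0"
    and unstable: "static_energy pL pR < c * (pR 0 0)\<^sup>2"
  shows "\<exists>la fL fR. la > 0 \<and> forced_mode la 1 fL fR \<and> c * fR 0 0 = 1 \<and>
     (\<forall>k x. (fL k has_real_derivative fL (Suc k) x) (at x)) \<and>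
     (\<forall>k x. (fR k has_real_derivative fR (Suc k) x) (at x))"
proof -
  have "\<forall>la. \<exists>fL fR. la > 0 \<longrightarrow> forced_mode la 1 fL fR \<and>
     (\<forall>k x. (fL k has_real_derivative fL (Suc k) x) (at x)) \<and>
     (\<forall>k x. (fR k has_real_derivative fR (Suc k) x) (at x))"
    using unit_forced_mode_exists[OF _ xi] by blast
  then obtain fL fR where f: "\<And>la. la > 0 \<Longrightarrow> forced_mode la 1 (fL la) (fR la)"
    and smooth: "\<And>la k x. la > 0 \<Longrightarrow> (fL la k has_real_derivative fL la (Suc k) x) (at x)"
      "\<And>la k x. la > 0 \<Longrightarrow> (fR la k has_real_derivative fR la (Suc k) x) (at x)"
    by metis
  define h where "h la = fR la 0 0" for la
  have t: "test_pair (fL la) (fR la)" if "la > 0" for la using f[OF that] by (simp add: forced_mode_def)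
  have self: "energy la (fL la) (fR la) (fL la) (fR la) = h la" if "la > 0" for la
    using forced_mode_weak_form[OF f[OF that] t[OF that]] by (simp add: h_def)
  have hpos: "h la > 0" if "la > 0" for la
  proof (rule ccontr)
    assume "\<not> h la > 0"
    hence "h la * energy la pL pR pL pR \<le> 0"
      using energy_nonneg[OF that p(1)] by (simp add: mult_nonpos_nonneg)
    moreover have "(pR 0 0)\<^sup>2 \<le> h la * energy la pL pR pL pR"
      using forced_mode_cauchy_schwarz[OF that f[OF that] p(1)] by (simp add: h_def)
    ultimately have "(pR 0 0)\<^sup>2 \<le> 0" by linarith
    thus False using p(2) by simp
  qed
  \<comment> \<open>The mode at \<open>l'\<close> is a test pair for the mode at \<open>l\<close>,
    and its energy at \<open>l\<close> is compared with its energy at \<open>l'\<close>, which is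
    \<open>h l'\<close>.\<close>
  have cmp: "h l' \<le> h l * max 1 ((l / l')\<^sup>2)" if l: "l > 0" "l' > 0" for l l'
  proof -
    have "(h l')\<^sup>2 \<le> h l * energy l (fL l') (fR l') (fL l') (fR l')"
      using forced_mode_cauchy_schwarz[OF l(1) f[OF l(1)] t[OF l(2)]] by (simp add: h_def)
    also have "\<dots> \<le> h l * (max 1 ((l / l')\<^sup>2) * h l')"
      using energy_rescale[OF l t[OF l(2)]] self[OF l(2)] hpos[OF l(1)] by (intro mult_left_mono) auto
    finally have "h l' * h l' \<le> (h l * max 1 ((l / l')\<^sup>2)) * h l'" by (simp add: power2_eq_square mult.assoc)
    thus ?thesis using hpos[OF l(2)] by (simp only: mult_le_cancel_right_pos)
  qed
  have cont: "continuous_on {0<..} h"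
    unfolding continuous_on_def
  proof
    fix l :: real assume "l \<in> {0<..}"
    hence l: "l > 0" by simp
    have ev: "eventually (\<lambda>x. x > 0) (at l within {0<..})"
      by (simp add: eventually_at_filter)
    \<comment> \<open>Both bounds come from \<open>cmp\<close>, with the roles of the two rates
      exchanged, and both tend to \<open>h l\<close>.\<close>
    show "(h \<longlongrightarrow> h l) (at l within {0<..})"
    proof (rule tendsto_sandwich)
      show "eventually (\<lambda>x. h l / max 1 ((x / l)\<^sup>2) \<le> h x) (at l within {0<..})"
        using ev
      proof eventually_elim
        case (elim x)
        have "0 < max 1 ((x / l)\<^sup>2)" by (simp add: less_max_iff_disj)
        thus ?case using cmp[OF elim l] by (simp add: pos_divide_le_eq)
      qed
      show "eventually (\<lambda>x. h x \<le> h l * max 1 ((l / x)\<^sup>2)) (at l within {0<..})"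
        using ev by eventually_elim (use cmp l in auto)
      have "((\<lambda>x. h l / max 1 ((x / l)\<^sup>2)) \<longlongrightarrow> h l / max 1 ((l / l)\<^sup>2)) (at l within {0<..})"
        using l by (intro tendsto_intros) (auto simp: max_def)
      thus "((\<lambda>x. h l / max 1 ((x / l)\<^sup>2)) \<longlongrightarrow> h l) (at l within {0<..})" using l by simp
      have "((\<lambda>x. h l * max 1 ((l / x)\<^sup>2)) \<longlongrightarrow> h l * max 1 ((l / l)\<^sup>2)) (at l within {0<..})"
        using l by (intro tendsto_intros) auto
      thus "((\<lambda>x. h l * max 1 ((l / x)\<^sup>2)) \<longlongrightarrow> h l) (at l within {0<..})" using l by simp
    qed
  qed
  obtain A C where poly: "\<And>la. energy la pL pR pL pR = la\<^sup>2 * A + la * C + static_energy pL pR"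
    using energy_polynomial[OF p(1)] by blast
  have "((\<lambda>la. la\<^sup>2 * A + la * C + static_energy pL pR) \<longlongrightarrow> 0\<^sup>2 * A + 0 * C + static_energy pL pR) (at_right 0)"
    by (intro tendsto_intros)
  hence "eventually (\<lambda>la. la\<^sup>2 * A + la * C + static_energy pL pR < c * (pR 0 0)\<^sup>2) (at_right 0)"
    using unstable by (intro order_tendstoD(2)) auto
  moreover have "eventually (\<lambda>la. la > (0::real)) (at_right 0)" by (rule eventually_at_right_less)
  ultimately have "eventually (\<lambda>la. 0 < la \<and> energy la pL pR pL pR < c * (pR 0 0)\<^sup>2) (at_right 0)"
    unfolding poly by eventually_elim auto
  then obtain l1 where l1: "l1 > 0" "energy l1 pL pR pL pR < c * (pR 0 0)\<^sup>2"
    by (metis (mono_tags, lifting) eventually_happens' trivial_limit_at_right_real)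
  \<comment> \<open>Cauchy-Schwarz against the unstable pair, whose energy at \<open>l1\<close> is
    still below \<open>c\<close> times its squared value at \<open>0\<close>.\<close>
  have high: "1 / c \<le> h l1"
  proof -
    have "1 * (pR 0 0)\<^sup>2 \<le> h l1 * energy l1 pL pR pL pR"
      using forced_mode_cauchy_schwarz[OF l1(1) f[OF l1(1)] p(1)] by (simp add: h_def)
    also have "\<dots> \<le> h l1 * (c * (pR 0 0)\<^sup>2)"
      using l1 hpos[of l1] by (intro mult_left_mono) auto
    finally have "1 * (pR 0 0)\<^sup>2 \<le> (h l1 * c) * (pR 0 0)\<^sup>2" by (simp add: mult.assoc)
    moreover have "0 < (pR 0 0)\<^sup>2" using p(2) by simp
    ultimately have "1 \<le> h l1 * c" by (simp only: mult_le_cancel_right_pos)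
    thus ?thesis using c by (simp add: field_simps)
  qed
  \<comment> \<open>\<open>l2 \<ge> 1\<close> and \<open>l2 * rhop \<ge> c\<close> together give
    \<open>l2\<^sup>2 * rhop \<ge> c\<close>; \<open>l2 \<ge> l1\<close> orders the interval for the
    intermediate value theorem.\<close>
  define l2 where "l2 = max l1 (max 1 (c / rhop))"
  have l2: "l2 > 0" "l1 \<le> l2" "1 \<le> l2" "c / rhop \<le> l2" using l1 by (auto simp: l2_def)
  have low: "h l2 \<le> 1 / c"
  proof -
    \<comment> \<open>The energy of the mode is its own value at \<open>0\<close>, so the lower
      bound at \<open>x = 0\<close> becomes an inequality for \<open>h l2\<close> alone.\<close>
    have "l2\<^sup>2 * rhop * (h l2)\<^sup>2 \<le> h l2"
      using energy_lower_bound(2)[OF l2(1) t[OF l2(1)], of 0] static_energy_nonneg[of "fL l2" "fR l2"]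
        self[OF l2(1)] by (simp add: h_def)
    hence "(l2\<^sup>2 * rhop * h l2) * h l2 \<le> 1 * h l2" by (simp add: power2_eq_square mult.assoc)
    hence 1: "l2\<^sup>2 * rhop * h l2 \<le> 1" using hpos[OF l2(1)] by (simp only: mult_le_cancel_right_pos)
    have "c \<le> l2 * rhop" using l2 rho_pos by (simp add: field_simps)
    also have "\<dots> \<le> l2\<^sup>2 * rhop" using l2 rho_pos by (simp add: power2_eq_square)
    finally have "c * h l2 \<le> l2\<^sup>2 * rhop * h l2" using hpos[OF l2(1)] by (intro mult_right_mono) auto
    hence "c * h l2 \<le> 1" using 1 by linarith
    thus ?thesis using c by (simp add: field_simps)
  qed
  obtain l where l: "l1 \<le> l" "h l = 1 / c"
    using IVT2'[of h l2 "1 / c" l1] low high l2(2) continuous_on_subset[OF cont, of "{l1..l2}"] l1(1) by force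
  have "l > 0" using l l1 by simp
  thus ?thesis using f smooth l c unfolding h_def
    by (intro exI[of _ l] exI[of _ "fL l"] exI[of _ "fR l"]) auto
qed

section \<open>Passing between modes and solutions; triviality of stable solutions\<close>

lemma forced_mode_is_solution:
  assumes f: "forced_mode la F fL fR" and F: "F = g * (rhop - rhom) * \<xi>\<^sup>2 * fR 0 0"
    and cL: "continuous_on {-1..0} (fL 4)" and cR: "continuous_on {0..1} (fR 4)"
  shows "is_solution g rhop rhom mup mum B \<xi> la (\<lambda>x. if x \<le> 0 then fL 0 x else fR 0 x)"
proof -
  let ?psi = "\<lambda>x. if x \<le> 0 then fL 0 x else fR 0 x"
  have t: "test_pair fL fR" using f by (simp add: forced_mode_def)
  hence j: "fL 0 0 = fR 0 0" "fL 1 0 = fR 1 0"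
    and bc: "fL 0 (-1) = 0" "fL 1 (-1) = 0" "fR 0 1 = 0" "fR 1 1 = 0"
    by (auto simp: test_pair_def)
  have CL: "Ck_on 4 {-1..0} ?psi fL" using f cL by (auto simp: Ck_on_def forced_mode_def)
  have CR: "Ck_on 4 {0..1} ?psi fR" using f cR j by (auto simp: Ck_on_def forced_mode_def)
  have oL: "- (la^2 * rhom * (\<xi>^2 * fL 0 x - fL 2 x)) = mum * la * (\<xi>^4 * fL 0 x - 2 * \<xi>^2 * fL 2 x + fL 4 x)
           + \<bar>B\<bar>^2 * (\<xi>^4 * fL 0 x - \<xi>^2 * fL 2 x)" if "x \<in> {-1<..<0}" for x
  proof -
    have "ode_residual rhom mum (B\<^sup>2) \<xi> la fL x = 0" using f that by (auto simp: forced_mode_def)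
    thus ?thesis unfolding ode_residual_def power2_abs by linarith
  qed
  have oR: "- (la^2 * rhop * (\<xi>^2 * fR 0 x - fR 2 x)) = mup * la * (\<xi>^4 * fR 0 x - 2 * \<xi>^2 * fR 2 x + fR 4 x)
           + \<bar>B\<bar>^2 * (\<xi>^4 * fR 0 x - \<xi>^2 * fR 2 x)" if "x \<in> {0<..<1}" for x
  proof -
    have "ode_residual rhop mup (B\<^sup>2) \<xi> la fR x = 0" using f that by (auto simp: forced_mode_def)
    thus ?thesis unfolding ode_residual_def power2_abs by linarith
  qed
  have J: "mup * la * (\<xi>\<^sup>2 * fR 0 0 + fR 2 0) - mum * la * (\<xi>\<^sup>2 * fL 0 0 + fL 2 0) = 0"
    and "mup * la * (fR 3 0 - 3 * \<xi>\<^sup>2 * fR 1 0) - mum * la * (fL 3 0 - 3 * \<xi>\<^sup>2 * fL 1 0)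
       - (la\<^sup>2 * rhop * fR 1 0 - la\<^sup>2 * rhom * fL 1 0) = F"
    using f by (auto simp: forced_mode_def)
  hence J3: "mup * la * (fR 3 0 - 3 * \<xi>\<^sup>2 * fR 1 0) - mum * la * (fL 3 0 - 3 * \<xi>\<^sup>2 * fL 1 0)
       = (la\<^sup>2 * rhop * fR 1 0 - la\<^sup>2 * rhom * fL 1 0) + g * (rhop - rhom) * \<xi>^2 * ?psi 0"
    unfolding F using j by simp
  show ?thesis
    unfolding is_solution_def
    by (rule exI[of _ fL], rule exI[of _ fR], intro conjI ballI CL CR oL oR J J3) (auto simp: j[simplified] bc[simplified])
qed

lemma is_solution_forced_mode:
  assumes "is_solution g rhop rhom mup mum B \<xi> la psi"
  obtains dL dR where "forced_mode la (g * (rhop - rhom) * \<xi>\<^sup>2 * psi 0) dL dR"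
    "\<And>x. x \<in> {-1..0} \<Longrightarrow> dL 0 x = psi x" "\<And>x. x \<in> {0..1} \<Longrightarrow> dR 0 x = psi x"
proof -
  from assms obtain dL dR where CL: "Ck_on 4 {-1..0} psi dL" and CR: "Ck_on 4 {0..1} psi dR"
    and oL: "\<forall>x\<in>{-1<..<0}. - (la^2 * rhom * (\<xi>^2 * dL 0 x - dL 2 x))
         = mum * la * (\<xi>^4 * dL 0 x - 2 * \<xi>^2 * dL 2 x + dL 4 x) + \<bar>B\<bar>^2 * (\<xi>^4 * dL 0 x - \<xi>^2 * dL 2 x)"
    and oR: "\<forall>x\<in>{0<..<1}. - (la^2 * rhop * (\<xi>^2 * dR 0 x - dR 2 x))
         = mup * la * (\<xi>^4 * dR 0 x - 2 * \<xi>^2 * dR 2 x + dR 4 x) + \<bar>B\<bar>^2 * (\<xi>^4 * dR 0 x - \<xi>^2 * dR 2 x)"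
    and j: "dR 0 0 - dL 0 0 = 0" "dR 1 0 - dL 1 0 = 0"
      "mup * la * (\<xi>^2 * dR 0 0 + dR 2 0) - mum * la * (\<xi>^2 * dL 0 0 + dL 2 0) = 0"
      "mup * la * (dR 3 0 - 3 * \<xi>^2 * dR 1 0) - mum * la * (dL 3 0 - 3 * \<xi>^2 * dL 1 0)
        = (la^2 * rhop * dR 1 0 - la^2 * rhom * dL 1 0) + g * (rhop - rhom) * \<xi>^2 * psi 0"
    and bc: "psi (-1) = 0" "psi 1 = 0" "dL 1 (-1) = 0" "dR 1 1 = 0"
    unfolding is_solution_def by blast
  have eq: "\<And>x. x \<in> {-1..0} \<Longrightarrow> dL 0 x = psi x" "\<And>x. x \<in> {0..1} \<Longrightarrow> dR 0 x = psi x"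
    and dL: "\<forall>k<4. \<forall>x\<in>{-1..0}. (dL k has_real_derivative dL (Suc k) x) (at x within {-1..0})"
    and dR: "\<forall>k<4. \<forall>x\<in>{0..1}. (dR k has_real_derivative dR (Suc k) x) (at x within {0..1})"
    using CL CR unfolding Ck_on_def by auto
  have "continuous_on {-1..0} (dL 2)"
    by (rule DERIV_continuous_on[where D = "dL (Suc 2)"]) (use dL[rule_format, of 2] in auto)
  moreover have "continuous_on {0..1} (dR 2)"
    by (rule DERIV_continuous_on[where D = "dR (Suc 2)"]) (use dR[rule_format, of 2] in auto)
  ultimately have "test_pair dL dR"
    unfolding test_pair_def C2_family_def using dL dR j(1,2) bc eq by auto
  moreover have "\<forall>x\<in>{-1<..<0}. ode_residual rhom mum (B\<^sup>2) \<xi> la dL x = 0"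
    using oL unfolding ode_residual_def power2_abs by (metis add.commute add.right_inverse)
  moreover have "\<forall>x\<in>{0<..<1}. ode_residual rhop mup (B\<^sup>2) \<xi> la dR x = 0"
    using oR unfolding ode_residual_def power2_abs by (metis add.commute add.right_inverse)
  ultimately have "forced_mode la (g * (rhop - rhom) * \<xi>\<^sup>2 * psi 0) dL dR"
    unfolding forced_mode_def using dL dR j(3,4) by simp
  thus ?thesis using that eq by blast
qed

text \<open>Tested with itself, the solution has energy
  \<open>\<xi>\<^sup>2 * (g * (rhop - rhom) * (psi 0)\<^sup>2)\<close>, which the stability
  inequality, multiplied by \<open>\<xi>\<^sup>2\<close>, bounds by \<open>static_energy\<close>.
  The excess in \<open>energy_lower_bound\<close> must then vanish at every point.\<close>

lemma stable_imp_trivial: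
  assumes sol: "is_solution g rhop rhom mup mum B \<xi> la psi" and la: "la > 0"
    and stable: "\<And>w. (psi, w) \<in> H01_nonzero \<Longrightarrow> g * (rhop - rhom) * (psi 0)\<^sup>2
      \<le> B\<^sup>2 * (\<xi>\<^sup>2 * (LINT x:{-1..1}|lborel. (psi x)\<^sup>2) + (LINT x:{-1..1}|lborel. (w x)\<^sup>2))"
  shows "\<forall>x\<in>{-1..1}. psi x = 0"
proof (rule ccontr)
  assume nz: "\<not> (\<forall>x\<in>{-1..1}. psi x = 0)"
  obtain dL dR where f: "forced_mode la (g * (rhop - rhom) * \<xi>\<^sup>2 * psi 0) dL dR"
    and eq: "\<And>x. x \<in> {-1..0} \<Longrightarrow> dL 0 x = psi x" "\<And>x. x \<in> {0..1} \<Longrightarrow> dR 0 x = psi x"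
    using is_solution_forced_mode[OF sol] by blast
  have t: "test_pair dL dR" using f by (simp add: forced_mode_def)
  define w where "w = (\<lambda>x. if x \<le> 0 then dL 1 x else dR 1 x)"
  have "(psi, w) \<in> H01" unfolding w_def by (rule test_pair_H01(1)[OF t eq])
  hence "(psi, w) \<in> H01_nonzero" using nz by (auto simp: H01_nonzero_def)
  have W: "(LINT x:{-1..1}|lborel. (w x)\<^sup>2) = integral {-1..0} (\<lambda>x. (dL 1 x)\<^sup>2) + integral {0..1} (\<lambda>x. (dR 1 x)\<^sup>2)"
    unfolding w_def by (rule test_pair_H01(2)[OF t eq])
  have P: "(LINT x:{-1..1}|lborel. (psi x)\<^sup>2) = integral {-1..0} (\<lambda>x. (dL 0 x)\<^sup>2) + integral {0..1} (\<lambda>x. (dR 0 x)\<^sup>2)"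
    by (rule test_pair_H01(3)[OF t eq])
  from stable[OF \<open>(psi, w) \<in> H01_nonzero\<close>] have "\<xi>\<^sup>2 * (g * (rhop - rhom) * (psi 0)\<^sup>2) \<le> \<xi>\<^sup>2 * (B\<^sup>2 * (\<xi>\<^sup>2 * (LINT x:{-1..1}|lborel. (psi x)\<^sup>2)
      + (LINT x:{-1..1}|lborel. (w x)\<^sup>2)))" by (intro mult_left_mono) auto
  hence "\<xi>\<^sup>2 * (g * (rhop - rhom) * (psi 0)\<^sup>2) \<le> static_energy dL dR"
    unfolding static_energy_def W[symmetric] P[symmetric] by (simp add: mult_ac)
  moreover have "energy la dL dR dL dR = \<xi>\<^sup>2 * (g * (rhop - rhom) * (psi 0)\<^sup>2)"
    using forced_mode_weak_form[OF f t] eq(2)[of 0] by (simp add: power2_eq_square)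
  ultimately have E: "energy la dL dR dL dR \<le> static_energy dL dR" by simp
  have "psi x = 0" if "x \<in> {-1..1}" for x
  proof (cases "x \<le> 0")
    case True
    hence "la\<^sup>2 * rhom * (psi x)\<^sup>2 \<le> 0"
      using energy_lower_bound(1)[OF la t, of x] E eq(1)[of x] that by simp
    thus ?thesis using la rho_pos by (simp add: mult_le_0_iff)
  next
    case False
    hence "la\<^sup>2 * rhop * (psi x)\<^sup>2 \<le> 0"
      using energy_lower_bound(2)[OF la t, of x] E eq(2)[of x] that by simp
    thus ?thesis using la rho_pos by (simp add: mult_le_0_iff)
  qed
  thus False using nz by blast
qed

end

section \<open>Reading the critical numbers as inequalities\<close>

lemma Bc_le_imp_trace_le:
  assumes G: "g * (rhop - rhom) > 0" and B: "Bc g rhop rhom \<le> \<bar>B\<bar>" and H: "(psi, w) \<in> H01_nonzero"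
  shows "g * (rhop - rhom) * (psi 0)\<^sup>2 \<le> B\<^sup>2 * (LINT x:{-1..1}|lborel. (w x)\<^sup>2)"
proof -
  define A where "A = {g * (rhop - rhom) * (psi 0)^2 / (LBINT x=-1..1. \<bar>w x\<bar>^2) | psi w. (psi, w) \<in> H01_nonzero}"
  have nn: "0 \<le> (LINT x:{-1..1}|lborel. (w x)\<^sup>2)" if "(psi, w) \<in> H01" for psi w
    using H01_trace_le[OF that] zero_le_power2[of "psi 0"] by linarith
  \<comment> \<open>A real \<open>Sup\<close> bounds its set only if the set is bounded above, which
    the trace inequality ensures.\<close>
  have "bdd_above A"
  proof (rule bdd_aboveI)
    fix a assume "a \<in> A"
    then obtain psi w where a: "a = g * (rhop - rhom) * (psi 0)^2 / (LINT x:{-1..1}|lborel. (w x)\<^sup>2)"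
      and h: "(psi, w) \<in> H01" by (auto simp: A_def LBINT_unit H01_nonzero_def)
    have "g * (rhop - rhom) * (psi 0)^2 \<le> g * (rhop - rhom) * (LINT x:{-1..1}|lborel. (w x)\<^sup>2)"
      using G H01_trace_le[OF h] by (intro mult_left_mono) auto
    thus "a \<le> g * (rhop - rhom)" unfolding a using nn[OF h] G
      by (cases "(LINT x:{-1..1}|lborel. (w x)\<^sup>2) = 0") (auto simp: pos_divide_le_eq)
  qed
  moreover have "g * (rhop - rhom) * (psi 0)^2 / (LINT x:{-1..1}|lborel. (w x)\<^sup>2) \<in> A"
    using H by (auto simp: A_def LBINT_unit)
  ultimately have "g * (rhop - rhom) * (psi 0)^2 / (LINT x:{-1..1}|lborel. (w x)\<^sup>2) \<le> Bc_sq g rhop rhom"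
    unfolding Bc_sq_def A_def[symmetric] by (intro cSup_upper)
  also have "Bc_sq g rhop rhom \<le> B\<^sup>2"
    using B unfolding Bc_def by (metis real_sqrt_abs real_sqrt_le_iff)
  finally have q: "g * (rhop - rhom) * (psi 0)^2 / (LINT x:{-1..1}|lborel. (w x)\<^sup>2) \<le> B\<^sup>2" .
  have h: "(psi, w) \<in> H01" using H by (simp add: H01_nonzero_def)
  show ?thesis
  proof (cases "(LINT x:{-1..1}|lborel. (w x)\<^sup>2) = 0")
    case True
    \<comment> \<open>With a zero denominator the quotient is \<open>0\<close> by convention and
      \<open>q\<close> is void; the trace inequality forces \<open>psi 0 = 0\<close>.\<close>
    thus ?thesis using H01_trace_le[OF h] by simp
  next
    case False
    hence "(LINT x:{-1..1}|lborel. (w x)\<^sup>2) > 0" using nn[OF h] by simp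
    thus ?thesis using q by (simp add: pos_divide_le_eq)
  qed
qed

lemma xi_hc_le_imp_trace_le:
  assumes G: "g * (rhop - rhom) > 0" and B: "B \<noteq> 0" and xi: "xi_hc g rhop rhom B \<le> \<bar>\<xi>\<bar>"
    and H: "(psi, w) \<in> H01_nonzero"
  shows "g * (rhop - rhom) * (psi 0)\<^sup>2
    \<le> B\<^sup>2 * (\<xi>\<^sup>2 * (LINT x:{-1..1}|lborel. (psi x)\<^sup>2) + (LINT x:{-1..1}|lborel. (w x)\<^sup>2))"
proof -
  define A where "A = {(g * (rhop - rhom) * (psi 0)^2 - \<bar>B\<bar>^2 * (LBINT x=-1..1. \<bar>w x\<bar>^2))
           / (\<bar>B\<bar>^2 * (LBINT x=-1..1. \<bar>psi x\<bar>^2)) | psi w. (psi, w) \<in> H01_nonzero}"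
  \<comment> \<open>This choice gives \<open>2 * s * B\<^sup>2 = g * (rhop - rhom)\<close>. Together
    with \<open>sinh s \<le> cosh s\<close> it turns the energy trace inequality into the bound
    \<open>s\<^sup>2\<close> for all quotients.\<close>
  define s where "s = g * (rhop - rhom) / (2 * B\<^sup>2)"
  have s: "s > 0" and B2: "B\<^sup>2 > 0" using G B by (auto simp: s_def)
  have sB: "2 * s * B\<^sup>2 = g * (rhop - rhom)" using B by (simp add: s_def)
  have bound: "g * (rhop - rhom) * (psi 0)\<^sup>2 \<le> B\<^sup>2 * ((LINT x:{-1..1}|lborel. (w x)\<^sup>2) + s\<^sup>2 * (LINT x:{-1..1}|lborel. (psi x)\<^sup>2))"
    if h: "(psi, w) \<in> H01" for psi w
  proof -
    have "sinh s * (2 * s * (psi 0)\<^sup>2) \<le> cosh s * (2 * s * (psi 0)\<^sup>2)"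
      using s by (intro mult_right_mono) (auto simp: sinh_le_cosh_real)
    also have "\<dots> \<le> sinh s * ((LINT x:{-1..1}|lborel. (w x)\<^sup>2) + s\<^sup>2 * (LINT x:{-1..1}|lborel. (psi x)\<^sup>2))"
      using H01_trace_le_energy[OF h s] by (simp add: mult_ac)
    finally have "2 * s * (psi 0)\<^sup>2 \<le> (LINT x:{-1..1}|lborel. (w x)\<^sup>2) + s\<^sup>2 * (LINT x:{-1..1}|lborel. (psi x)\<^sup>2)"
      using s by simp
    from mult_left_mono[OF this, of "B\<^sup>2"] show ?thesis by (simp add: sB[symmetric] mult_ac)
  qed
  have nn: "0 \<le> (LINT x:{-1..1}|lborel. (h x)\<^sup>2)" for h :: "real \<Rightarrow> real"
    unfolding set_lebesgue_integral_def by (rule Bochner_Integration.integral_nonneg) simp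
  have "bdd_above A"
  proof (rule bdd_aboveI)
    fix a assume "a \<in> A"
    then obtain psi w where a: "a = (g * (rhop - rhom) * (psi 0)^2 - B\<^sup>2 * (LINT x:{-1..1}|lborel. (w x)\<^sup>2))
       / (B\<^sup>2 * (LINT x:{-1..1}|lborel. (psi x)\<^sup>2))"
      and h: "(psi, w) \<in> H01" by (auto simp: A_def LBINT_unit H01_nonzero_def)
    show "a \<le> s\<^sup>2"
    proof (cases "(LINT x:{-1..1}|lborel. (psi x)\<^sup>2) = 0")
      case False
      hence "B\<^sup>2 * (LINT x:{-1..1}|lborel. (psi x)\<^sup>2) > 0" using nn[of psi] B2 by simp
      thus ?thesis unfolding a using bound[OF h] by (simp add: pos_divide_le_eq algebra_simps)
    qed (simp add: a)
  qed
  moreover have "(g * (rhop - rhom) * (psi 0)^2 - B\<^sup>2 * (LINT x:{-1..1}|lborel. (w x)\<^sup>2))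
       / (B\<^sup>2 * (LINT x:{-1..1}|lborel. (psi x)\<^sup>2)) \<in> A"
    using H unfolding A_def LBINT_unit power2_abs by blast
  ultimately have "(g * (rhop - rhom) * (psi 0)^2 - B\<^sup>2 * (LINT x:{-1..1}|lborel. (w x)\<^sup>2))
       / (B\<^sup>2 * (LINT x:{-1..1}|lborel. (psi x)\<^sup>2)) \<le> xi_hc_sq g rhop rhom B"
    unfolding xi_hc_sq_def A_def[symmetric] by (intro cSup_upper)
  \<comment> \<open>\<open>sqrt\<close> is odd and strictly increasing on all reals, so a negative
    supremum calls for no separate case.\<close>
  also have "xi_hc_sq g rhop rhom B \<le> \<xi>\<^sup>2"
    using xi unfolding xi_hc_def by (metis real_sqrt_abs real_sqrt_le_iff)
  finally have q: "(g * (rhop - rhom) * (psi 0)^2 - B\<^sup>2 * (LINT x:{-1..1}|lborel. (w x)\<^sup>2))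
       / (B\<^sup>2 * (LINT x:{-1..1}|lborel. (psi x)\<^sup>2)) \<le> \<xi>\<^sup>2" .
  have h: "(psi, w) \<in> H01" using H by (simp add: H01_nonzero_def)
  show ?thesis
  proof (cases "(LINT x:{-1..1}|lborel. (psi x)\<^sup>2) = 0")
    case True
    thus ?thesis using bound[OF h] by simp
  next
    case False
    hence "B\<^sup>2 * (LINT x:{-1..1}|lborel. (psi x)\<^sup>2) > 0" using nn[of psi] B2 by simp
    thus ?thesis using q by (simp add: pos_divide_le_eq algebra_simps)
  qed
qed

text \<open>Allows a near-maximiser to be extracted from a supremum.\<close>

lemma H01_nonzero_nonempty: "\<exists>psi w. (psi, w) \<in> H01_nonzero"
proof (intro exI)
  let ?psi = "\<lambda>x::real. 1 - x\<^sup>2" and ?w = "\<lambda>x::real. - 2 * x"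
  have FTC: "(LINT t:{-1..x}|lborel. ?w t) = ?psi x - ?psi (-1)" if "x \<in> {-1..1}" for x :: real
    using that by (intro set_integral_FTC_except[where S = "{}"] borel_integrable_atLeastAtMost' continuous_intros)
      (auto intro!: derivative_eq_intros)
  have "?psi x = (LINT t:{-1..x}|lborel. ?w t)" if "x \<in> {-1..1}" for x
    unfolding FTC[OF that] by simp
  moreover have "set_integrable lborel {-1..1} ?w" "set_integrable lborel {-1..1} (\<lambda>x. (?w x)\<^sup>2)"
    by (intro borel_integrable_atLeastAtMost' continuous_intros)+
  moreover have "?psi (-1) = 0" "?psi 1 = 0" by simp_all
  ultimately have "(?psi, ?w) \<in> H01"
    unfolding H01_iff by blast
  thus "(?psi, ?w) \<in> H01_nonzero" by (auto simp: H01_nonzero_def intro!: bexI[of _ 0])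
qed

text \<open>A competitor whose quotient exceeds \<open>\<xi>\<^sup>2\<close> is put into the sharp
  trace inequality, and \<open>psi 0\<close> cancels. What remains is the explicit instability
  condition \<open>2 * B\<^sup>2 * \<xi> * coth \<xi> < g * (rhop - rhom)\<close>.\<close>

lemma less_xi_hc_imp:
  assumes B: "B \<noteq> 0" and xi: "0 < \<xi>" "\<xi> < xi_hc g rhop rhom B"
  shows "B\<^sup>2 * (2 * \<xi> * cosh \<xi>) < g * (rhop - rhom) * sinh \<xi>"
proof -
  have "\<xi>\<^sup>2 < xi_hc_sq g rhop rhom B"
    using xi unfolding xi_hc_def by (metis abs_of_pos real_sqrt_abs real_sqrt_less_iff)
  then obtain psi w where H: "(psi, w) \<in> H01_nonzero"
    and q: "\<xi>\<^sup>2 < (g * (rhop - rhom) * (psi 0)^2 - \<bar>B\<bar>^2 * (LBINT x=-1..1. \<bar>w x\<bar>^2))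
           / (\<bar>B\<bar>^2 * (LBINT x=-1..1. \<bar>psi x\<bar>^2))"
    unfolding xi_hc_sq_def using H01_nonzero_nonempty by (elim less_cSupE) auto
  have h: "(psi, w) \<in> H01" using H by (simp add: H01_nonzero_def)
  let ?P = "LINT x:{-1..1}|lborel. (psi x)\<^sup>2" and ?W = "LINT x:{-1..1}|lborel. (w x)\<^sup>2"
  have q: "\<xi>\<^sup>2 < (g * (rhop - rhom) * (psi 0)^2 - B\<^sup>2 * ?W) / (B\<^sup>2 * ?P)"
    using q by (simp add: LBINT_unit)
  \<comment> \<open>Otherwise the quotient would be \<open>0\<close>, which does not exceed
    \<open>\<xi>\<^sup>2\<close>.\<close>
  have "?P \<noteq> 0" using q by (auto simp: not_less)
  moreover have "0 \<le> ?P"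
    unfolding set_lebesgue_integral_def by (rule Bochner_Integration.integral_nonneg) simp
  ultimately have "B\<^sup>2 * ?P > 0" using B by simp
  hence "B\<^sup>2 * (?W + \<xi>\<^sup>2 * ?P) < g * (rhop - rhom) * (psi 0)\<^sup>2"
    using q by (simp add: pos_less_divide_eq algebra_simps)
  hence "sinh \<xi> * (B\<^sup>2 * (?W + \<xi>\<^sup>2 * ?P)) < sinh \<xi> * (g * (rhop - rhom) * (psi 0)\<^sup>2)"
    using xi by (intro mult_strict_left_mono) auto
  moreover have "B\<^sup>2 * (2 * \<xi> * cosh \<xi> * (psi 0)\<^sup>2) \<le> B\<^sup>2 * (sinh \<xi> * (?W + \<xi>\<^sup>2 * ?P))"
    using H01_trace_le_energy[OF h xi(1)] by (intro mult_left_mono) auto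
  ultimately have "(B\<^sup>2 * (2 * \<xi> * cosh \<xi>)) * (psi 0)\<^sup>2 < (g * (rhop - rhom) * sinh \<xi>) * (psi 0)\<^sup>2"
    by (simp add: mult_ac)
  thus ?thesis by (simp add: mult_less_cancel_right)
qed

lemma unstable_solution_exists:
  assumes "g > 0" and "rhop > rhom" and "rhom > 0" and "mup > 0" and "mum > 0" and "B \<noteq> 0"
    and xi: "0 < \<xi>" "\<xi> < xi_hc g rhop rhom B"
  shows "\<exists>la psi. la > 0 \<and> is_solution g rhop rhom mup mum B \<xi> la psi \<and>
     smooth_on {-1<..<0} psi \<and> smooth_on {0<..<1} psi \<and> psi 0 \<noteq> 0"
proof -
  interpret slab rhop rhom mup mum B \<xi> using assms by unfold_locales auto
  have G: "g * (rhop - rhom) > 0" using assms by simp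
  have sh: "sinh \<xi> > 0" using xi by simp
  \<comment> \<open>The level at which \<open>c * Q\<close> equals
    \<open>B\<^sup>2 * \<xi>\<^sup>2\<close> times the energy bound of the near-optimal pair. By
    \<open>less_xi_hc_imp\<close>, multiplied by \<open>sinh \<xi>\<close>, it lies below the
    squared value of the minimiser at \<open>0\<close>.\<close>
  define Q where "Q = B\<^sup>2 * (2 * \<xi> * sinh \<xi> * cosh \<xi>) / (g * (rhop - rhom))"
  have "B\<^sup>2 * (2 * \<xi> * cosh \<xi>) * sinh \<xi> < g * (rhop - rhom) * sinh \<xi> * sinh \<xi>"
    using less_xi_hc_imp[OF \<open>B \<noteq> 0\<close> xi] sh by (rule mult_strict_right_mono)
  hence "Q < (sinh \<xi>)\<^sup>2" unfolding Q_def using G by (simp add: pos_divide_less_eq power2_eq_square mult_ac)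
  then obtain pL pR where p: "test_pair pL pR" "pR 0 0 \<noteq> 0" "Q < (pR 0 0)\<^sup>2"
    and e: "\<xi>\<^sup>2 * (integral {-1..0} (\<lambda>x. (pL 0 x)\<^sup>2) + integral {0..1} (\<lambda>x. (pR 0 x)\<^sup>2))
        + (integral {-1..0} (\<lambda>x. (pL 1 x)\<^sup>2) + integral {0..1} (\<lambda>x. (pR 1 x)\<^sup>2)) \<le> 2 * \<xi> * sinh \<xi> * cosh \<xi>"
    by (rule near_optimal_test_pair[OF xi(1)])
  define c where "c = g * (rhop - rhom) * \<xi>\<^sup>2"
  have c: "c > 0" using G xi by (simp add: c_def)
  have "static_energy pL pR \<le> B\<^sup>2 * \<xi>\<^sup>2 * (2 * \<xi> * sinh \<xi> * cosh \<xi>)"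
    unfolding static_energy_def using e by (intro mult_left_mono) auto
  also have "\<dots> = c * Q" using assms(1,2) by (simp add: c_def Q_def)
  also have "\<dots> < c * (pR 0 0)\<^sup>2" using p(3) c by simp
  finally obtain la fL fR where la: "la > 0" and f: "forced_mode la 1 fL fR" and r: "c * fR 0 0 = 1"
    and dL: "\<forall>k x. (fL k has_real_derivative fL (Suc k) x) (at x)"
    and dR: "\<forall>k x. (fR k has_real_derivative fR (Suc k) x) (at x)"
    using resonant_mode_exists[OF xi(1) c p(1,2)] by blast
  let ?psi = "\<lambda>x. if x \<le> 0 then fL 0 x else fR 0 x"
  have "is_solution g rhop rhom mup mum B \<xi> la ?psi"
  proof (rule forced_mode_is_solution[OF f])
    show "1 = g * (rhop - rhom) * \<xi>\<^sup>2 * fR 0 0" using r by (simp add: c_def)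
    show "continuous_on {-1..0} (fL 4)" "continuous_on {0..1} (fR 4)"
      using dL dR by (meson DERIV_isCont continuous_at_imp_continuous_on)+
  qed
  moreover have "smooth_on {-1<..<0} ?psi" unfolding smooth_on_def
    using dL by (intro exI[of _ fL]) auto
  moreover have "smooth_on {0<..<1} ?psi" unfolding smooth_on_def
    using dR by (intro exI[of _ fR]) auto
  moreover have "?psi 0 \<noteq> 0" using r f by (auto simp: forced_mode_def test_pair_def)
  ultimately show ?thesis using la by blast
qed

text \<open>Only even powers of \<open>\<xi>\<close> occur.\<close>

lemma is_solution_abs: "is_solution g rhop rhom mup mum B \<bar>\<xi>\<bar> la psi = is_solution g rhop rhom mup mum B \<xi> la psi"
  unfolding is_solution_def by (simp add: power_even_abs)

theorem theorem2p2:
  fixes g rhop rhom mup mum B :: real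
  assumes "g > 0" and "rhop > rhom" and "rhom > 0" and "mup > 0" and "mum > 0" and "B \<noteq> 0"
  shows
    "(\<bar>B\<bar> \<ge> Bc g rhop rhom \<longrightarrow>
        (\<forall>\<xi> la psi. la > 0 \<and> is_solution g rhop rhom mup mum B \<xi> la psi
            \<longrightarrow> (\<forall>x\<in>{-1..1}. psi x = 0)))
   \<and> (\<bar>B\<bar> < Bc g rhop rhom \<longrightarrow>
        (\<forall>\<xi> la psi. \<bar>\<xi>\<bar> \<ge> xi_hc g rhop rhom B \<and> la > 0 \<and> is_solution g rhop rhom mup mum B \<xi> la psi
            \<longrightarrow> (\<forall>x\<in>{-1..1}. psi x = 0)))
   \<and> (\<bar>B\<bar> < Bc g rhop rhom \<longrightarrow>
        (\<exists>lam :: real \<Rightarrow> real. \<exists>Psi :: real \<Rightarrow> real \<Rightarrow> real.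
           \<forall>\<xi>. 0 < \<bar>\<xi>\<bar> \<and> \<bar>\<xi>\<bar> < xi_hc g rhop rhom B \<longrightarrow>
             lam \<xi> > 0 \<and> is_solution g rhop rhom mup mum B \<xi> (lam \<xi>) (Psi \<xi>) \<and>
             lam (-\<xi>) = lam \<xi> \<and> Psi (-\<xi>) = Psi \<xi> \<and>
             smooth_on {-1<..<0} (Psi \<xi>) \<and> smooth_on {0<..<1} (Psi \<xi>) \<and>
             Psi \<xi> 0 \<noteq> 0))"
proof -
  have G: "g * (rhop - rhom) > 0" using assms by simp
  have slab: "slab rhop rhom mup mum" using assms by unfold_locales auto
  have 1: "\<forall>x\<in>{-1..1}. psi x = 0"
    if B: "\<bar>B\<bar> \<ge> Bc g rhop rhom" and la: "la > 0" and sol: "is_solution g rhop rhom mup mum B \<xi> la psi" for \<xi> la psi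
  proof (rule slab.stable_imp_trivial[OF slab sol la])
    fix w assume H: "(psi, w) \<in> H01_nonzero"
    \<comment> \<open>In case (i) the inequality holds without the \<open>\<xi>\<^sup>2\<close>
      term, which is nonnegative and may be added.\<close>
    have "0 \<le> (LINT x:{-1..1}|lborel. (psi x)\<^sup>2)"
      unfolding set_lebesgue_integral_def by (rule Bochner_Integration.integral_nonneg) simp
    hence "0 \<le> B\<^sup>2 * (\<xi>\<^sup>2 * (LINT x:{-1..1}|lborel. (psi x)\<^sup>2))" by simp
    thus "g * (rhop - rhom) * (psi 0)\<^sup>2
      \<le> B\<^sup>2 * (\<xi>\<^sup>2 * (LINT x:{-1..1}|lborel. (psi x)\<^sup>2) + (LINT x:{-1..1}|lborel. (w x)\<^sup>2))"
      using Bc_le_imp_trace_le[OF G B H] unfolding distrib_left by linarith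
  qed
  have 2: "\<forall>x\<in>{-1..1}. psi x = 0"
    if "\<bar>\<xi>\<bar> \<ge> xi_hc g rhop rhom B" "la > 0" "is_solution g rhop rhom mup mum B \<xi> la psi" for \<xi> la psi
    using that by (intro slab.stable_imp_trivial[OF slab that(3)] xi_hc_le_imp_trace_le[OF G \<open>B \<noteq> 0\<close>])
  have "\<forall>z. \<exists>la psi. 0 < z \<and> z < xi_hc g rhop rhom B \<longrightarrow> la > 0 \<and> is_solution g rhop rhom mup mum B z la psi \<and>
     smooth_on {-1<..<0} psi \<and> smooth_on {0<..<1} psi \<and> psi 0 \<noteq> 0"
    using unstable_solution_exists[OF assms] by blast
  then obtain lam Psi where *: "\<And>z. 0 < z \<and> z < xi_hc g rhop rhom B \<Longrightarrow> lam z > 0 \<and>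
     is_solution g rhop rhom mup mum B z (lam z) (Psi z) \<and>
     smooth_on {-1<..<0} (Psi z) \<and> smooth_on {0<..<1} (Psi z) \<and> Psi z 0 \<noteq> 0"
    by metis
  have 3: "\<exists>lam :: real \<Rightarrow> real. \<exists>Psi :: real \<Rightarrow> real \<Rightarrow> real.
           \<forall>\<xi>. 0 < \<bar>\<xi>\<bar> \<and> \<bar>\<xi>\<bar> < xi_hc g rhop rhom B \<longrightarrow>
             lam \<xi> > 0 \<and> is_solution g rhop rhom mup mum B \<xi> (lam \<xi>) (Psi \<xi>) \<and>
             lam (-\<xi>) = lam \<xi> \<and> Psi (-\<xi>) = Psi \<xi> \<and>
             smooth_on {-1<..<0} (Psi \<xi>) \<and> smooth_on {0<..<1} (Psi \<xi>) \<and>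
             Psi \<xi> 0 \<noteq> 0"
    \<comment> \<open>Both families are evaluated at \<open>\<bar>\<xi>\<bar>\<close>, which makes
      them even by construction.\<close>
    using *[of "\<bar>_\<bar>", unfolded is_solution_abs]
    by (intro exI[of _ "\<lambda>\<xi>. lam \<bar>\<xi>\<bar>"] exI[of _ "\<lambda>\<xi>. Psi \<bar>\<xi>\<bar>"]) auto
  show ?thesis using 1 2 3 by blast
qed

end
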